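(* For every $r\ge 1$, the free regular $\star$-monoid $\mathbf{F}_r^\star$ of rank $r$ is not of type $\mathrm{FP}_2$.
   Context: Let $A$ be a set with $|A|=r$, let $A_\star=\{a^\star : a\in A\}$ be a disjoint copy of $A$, set $(a^\star)^\star=a$, and extend to an involution on words over $A\cup A_\star$ by $(xy)^\star=y^\star x^\star$. The free regular $\star$-monoid of rank $r$, denoted $\mathbf{F}_r^\star$, is the monoid with generators $A\cup A_\star$ and defining relations $ww^\star w=w$ for all words $w\in(A\cup A_\star)^\ast$. A monoid $M$ is of type $\mathrm{FP}_n$ if there is a projective resolution $(P_\ast,\partial_\ast)$ of the trivial left $\mathbb{Z}M$-module $\mathbb{Z}$ in which $P_i$ is finitely generated for all $1\le i\le n$. (For monoids with an involutive anti-automorphism, such as $\mathbf{F}_r^\star$, this is equivalent to the version with right modules.) *)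

theory Defs
  imports "HOL-Algebra.Module" "HOL-Algebra.RingHom" "HOL-Library.Poly_Mapping"
begin

section \<open>Left modules over a not necessarily commutative ring\<close>

text \<open>The locale \<^locale>\<open>module\<close> of HOL-Algebra requires a commutative ring of scalars.
  The following locale has the same axioms over an arbitrary ring, on the same record type; as there,
  the fields \<^term>\<open>monoid.mult M\<close> and \<^term>\<open>one M\<close> of a module carry no information.\<close>

locale left_module = R?: ring R + M?: abelian_group M
  for R :: "('r, 'x) ring_scheme" (structure) and M :: "('r, 'b, 'y) module_scheme" (structure) +
  assumes smult_closed [simp, intro]:
      "\<lbrakk>a \<in> carrier R; x \<in> carrier M\<rbrakk> \<Longrightarrow> a \<odot>\<^bsub>M\<^esub> x \<in> carrier M"
    and smult_l_distr:
      "\<lbrakk>a \<in> carrier R; b \<in> carrier R; x \<in> carrier M\<rbrakk>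
        \<Longrightarrow> (a \<oplus>\<^bsub>R\<^esub> b) \<odot>\<^bsub>M\<^esub> x = a \<odot>\<^bsub>M\<^esub> x \<oplus>\<^bsub>M\<^esub> b \<odot>\<^bsub>M\<^esub> x"
    and smult_r_distr:
      "\<lbrakk>a \<in> carrier R; x \<in> carrier M; y \<in> carrier M\<rbrakk>
        \<Longrightarrow> a \<odot>\<^bsub>M\<^esub> (x \<oplus>\<^bsub>M\<^esub> y) = a \<odot>\<^bsub>M\<^esub> x \<oplus>\<^bsub>M\<^esub> a \<odot>\<^bsub>M\<^esub> y"
    and smult_assoc1:
      "\<lbrakk>a \<in> carrier R; b \<in> carrier R; x \<in> carrier M\<rbrakk>
        \<Longrightarrow> (a \<otimes>\<^bsub>R\<^esub> b) \<odot>\<^bsub>M\<^esub> x = a \<odot>\<^bsub>M\<^esub> (b \<odot>\<^bsub>M\<^esub> x)"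
    and smult_one [simp]:
      "x \<in> carrier M \<Longrightarrow> \<one>\<^bsub>R\<^esub> \<odot>\<^bsub>M\<^esub> x = x"

definition left_module_hom ::
  "('r, 'x) ring_scheme \<Rightarrow> ('r, 'b, 'y) module_scheme \<Rightarrow> ('r, 'c, 'z) module_scheme \<Rightarrow> ('b \<Rightarrow> 'c) set"
  where "left_module_hom R M N =
    {f \<in> carrier M \<rightarrow> carrier N.
      (\<forall>x\<in>carrier M. \<forall>y\<in>carrier M. f (x \<oplus>\<^bsub>M\<^esub> y) = f x \<oplus>\<^bsub>N\<^esub> f y) \<and>
      (\<forall>a\<in>carrier R. \<forall>x\<in>carrier M. f (a \<odot>\<^bsub>M\<^esub> x) = a \<odot>\<^bsub>N\<^esub> f x)}"

definition finitely_generated_module ::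
  "('r, 'x) ring_scheme \<Rightarrow> ('r, 'b) module \<Rightarrow> bool"
  where "finitely_generated_module R M \<longleftrightarrow>
    (\<exists>S. finite S \<and> S \<subseteq> carrier M \<and>
      (\<forall>H. submodule H R M \<and> S \<subseteq> H \<longrightarrow> H = carrier M))"

text \<open>Projectivity is the lifting property against surjections \<open>g : N \<rightarrow> N'\<close>. HOL cannot quantify
  over all types inside a definition, so \<open>N\<close> and \<open>N'\<close> range over modules on fixed types. These are
  large enough to contain \<open>P\<close> itself and a free module mapping onto \<open>P\<close>, so nothing is lost: see
  \<open>projective_module_lift\<close> below, which yields the lifting property for \<open>N\<close> and \<open>N'\<close> on arbitrary
  types.\<close>

definition projective_module :: "('r, 'x) ring_scheme \<Rightarrow> ('r, 'b) module \<Rightarrow> bool"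
  where "projective_module R P \<longleftrightarrow>
    left_module R P \<and>
    (\<forall>(N :: ('r, 'b \<Rightarrow> 'r) module) (N' :: ('r, 'b) module). \<forall>g h.
      left_module R N \<and> left_module R N' \<and>
      g \<in> left_module_hom R N N' \<and> g ` carrier N = carrier N' \<and> h \<in> left_module_hom R P N' \<longrightarrow>
      (\<exists>k \<in> left_module_hom R P N. \<forall>x\<in>carrier P. g (k x) = h x))"

text \<open>A projective resolution
  \<open>\<dots> \<rightarrow> P 2 \<rightarrow> P 1 \<rightarrow> P 0 \<rightarrow> Z \<rightarrow> 0\<close>
  of \<open>Z\<close>, with boundary maps \<open>d i : P (Suc i) \<rightarrow> P i\<close> and augmentation \<open>e : P 0 \<rightarrow> Z\<close>.\<close>

definition projective_resolution ::
  "('r, 'x) ring_scheme \<Rightarrow> ('r, 'c) module \<Rightarrow> (nat \<Rightarrow> ('r, 'b) module) \<Rightarrow>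
    (nat \<Rightarrow> 'b \<Rightarrow> 'b) \<Rightarrow> ('b \<Rightarrow> 'c) \<Rightarrow> bool"
  where "projective_resolution R Z P d e \<longleftrightarrow>
    (\<forall>i. projective_module R (P i)) \<and>
    (\<forall>i. d i \<in> left_module_hom R (P (Suc i)) (P i)) \<and>
    e \<in> left_module_hom R (P 0) Z \<and>
    e ` carrier (P 0) = carrier Z \<and>
    d 0 ` carrier (P 1) = a_kernel (P 0) Z e \<and>
    (\<forall>i. d (Suc i) ` carrier (P (Suc (Suc i))) = a_kernel (P (Suc i)) (P i) (d i))"


section \<open>Integral monoid rings and the property FP\<open>\<^sub>n\<close>\<close>

text \<open>The additive group is the free abelian group on \<^term>\<open>carrier M\<close>, and
  multiplication is the bilinear extension of that of \<open>M\<close>.\<close>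

definition monoid_ring :: "('m, 'x) monoid_scheme \<Rightarrow> ('m \<Rightarrow>\<^sub>0 int) ring"
  where "monoid_ring M =
    \<lparr>carrier = {c. Poly_Mapping.keys c \<subseteq> carrier M},
     mult = (\<lambda>x y. frag_extend (\<lambda>a. frag_extend (\<lambda>b. frag_of (a \<otimes>\<^bsub>M\<^esub> b)) y) x),
     one = frag_of \<one>\<^bsub>M\<^esub>,
     zero = 0,
     add = (+)\<rparr>"

text \<open>The integers, with every element of \<open>M\<close> acting as the identity.\<close>

definition trivial_module :: "('m, 'x) monoid_scheme \<Rightarrow> ('m \<Rightarrow>\<^sub>0 int, int) module"
  where "trivial_module M =
    \<lparr>carrier = UNIV, mult = (*), one = 1, zero = 0, add = (+),
     smult = (\<lambda>c k. (\<Sum>m\<in>Poly_Mapping.keys c. Poly_Mapping.lookup c m) * k)\<rparr>"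

text \<open>The first argument is the type on which the modules of the resolution live; HOL has no
  existential quantifier over types. Not being of type FP\<open>\<^sub>n\<close> means
  \<^term>\<open>\<not> type_FP TYPE('b) n M\<close> for every type \<^typ>\<open>'b\<close>.\<close>

definition type_FP :: "'b itself \<Rightarrow> nat \<Rightarrow> ('m, 'x) monoid_scheme \<Rightarrow> bool"
  where "type_FP T n M \<longleftrightarrow>
    (\<exists>(P :: nat \<Rightarrow> ('m \<Rightarrow>\<^sub>0 int, 'b) module) d e.
      projective_resolution (monoid_ring M) (trivial_module M) P d e \<and>
      (\<forall>i. 1 \<le> i \<and> i \<le> n \<longrightarrow> finitely_generated_module (monoid_ring M) (P i)))"


section \<open>Monoid presentations and free regular \<open>\<star>\<close>-monoids\<close>

text \<open>The congruence on the free monoid \<^term>\<open>lists X\<close> generated by the relations \<open>R\<close>.\<close>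

inductive_set presentation_congruence :: "'x set \<Rightarrow> ('x list \<times> 'x list) set \<Rightarrow> ('x list \<times> 'x list) set"
  for X :: "'x set" and R :: "('x list \<times> 'x list) set"
  where
    step: "\<lbrakk>(u, v) \<in> R; u \<in> lists X; v \<in> lists X; p \<in> lists X; q \<in> lists X\<rbrakk>
      \<Longrightarrow> (p @ u @ q, p @ v @ q) \<in> presentation_congruence X R"
  | refl: "w \<in> lists X \<Longrightarrow> (w, w) \<in> presentation_congruence X R"
  | sym: "(u, v) \<in> presentation_congruence X R \<Longrightarrow> (v, u) \<in> presentation_congruence X R"
  | trans: "\<lbrakk>(u, v) \<in> presentation_congruence X R; (v, w) \<in> presentation_congruence X R\<rbrakk>
      \<Longrightarrow> (u, w) \<in> presentation_congruence X R"

definition presented_monoid :: "'x set \<Rightarrow> ('x list \<times> 'x list) set \<Rightarrow> 'x list set monoid"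
  where "presented_monoid X R =
    \<lparr>carrier = lists X // presentation_congruence X R,
     mult = (\<lambda>U V. \<Union>u\<in>U. \<Union>v\<in>V. presentation_congruence X R `` {u @ v}),
     one = presentation_congruence X R `` {[]}\<rparr>"

text \<open>The letter \<^term>\<open>Inl a\<close> stands for \<open>a\<close> and \<^term>\<open>Inr a\<close> for \<open>a\<^sup>\<star>\<close>.\<close>

definition word_star :: "('a + 'a) list \<Rightarrow> ('a + 'a) list"
  where "word_star w = rev (map (case_sum Inr Inl) w)"

definition free_regular_star_monoid :: "'a set \<Rightarrow> ('a + 'a) list set monoid"
  where "free_regular_star_monoid A =
    presented_monoid (A <+> A) {(w @ word_star w @ w, w) | w. w \<in> lists (A <+> A)}"


section \<open>Well-definedness\<close>

lemma word_star_word_star [simp]: "word_star (word_star w) = w"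
proof -
  have "case_sum Inr Inl (case_sum Inr Inl x) = x" for x :: "'a + 'a"
    by (cases x) auto
  then show ?thesis
    by (simp add: word_star_def rev_map o_def map_idI)
qed

lemma word_star_append [simp]: "word_star (u @ v) = word_star v @ word_star u"
  by (simp add: word_star_def)

lemma word_star_in_lists: "w \<in> lists (A <+> A) \<Longrightarrow> word_star w \<in> lists (A <+> A)"
  by (auto simp: word_star_def in_lists_conv_set)

lemma presentation_congruence_in_lists:
  "(u, v) \<in> presentation_congruence X R \<Longrightarrow> u \<in> lists X \<and> v \<in> lists X"
  by (induction rule: presentation_congruence.induct) auto

lemma equiv_presentation_congruence: "equiv (lists X) (presentation_congruence X R)"
proof (rule equivI)
  show "presentation_congruence X R \<subseteq> lists X \<times> lists X"
    using presentation_congruence_in_lists[of _ _ X R] by fast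
  show "refl_on (lists X) (presentation_congruence X R)"
    using presentation_congruence.refl[of _ X R] by (simp add: refl_on_def)
  show "Relation.sym (presentation_congruence X R)"
    by (rule symI) (rule presentation_congruence.sym)
  show "Relation.trans (presentation_congruence X R)"
    by (rule transI) (rule presentation_congruence.trans)
qed

lemma presentation_congruence_context:
  assumes "(u, v) \<in> presentation_congruence X R" "p \<in> lists X" "q \<in> lists X"
  shows "(p @ u @ q, p @ v @ q) \<in> presentation_congruence X R"
  using assms
proof (induction rule: presentation_congruence.induct)
  case (step u v p' q')
  then have "((p @ p') @ u @ (q' @ q), (p @ p') @ v @ (q' @ q)) \<in> presentation_congruence X R"
    by (intro presentation_congruence.step) auto
  then show ?case by simp
next
  case (refl w)
  then show ?case by (intro presentation_congruence.refl) auto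
qed (auto intro: presentation_congruence.sym presentation_congruence.trans)

lemma presentation_congruence_append:
  assumes "(u, u') \<in> presentation_congruence X R" "(v, v') \<in> presentation_congruence X R"
  shows "(u @ v, u' @ v') \<in> presentation_congruence X R"
proof -
  have "(u @ v, u' @ v) \<in> presentation_congruence X R"
    using presentation_congruence_context[OF assms(1), of "[]" v]
      presentation_congruence_in_lists[OF assms(2)] by simp
  moreover have "(u' @ v, u' @ v') \<in> presentation_congruence X R"
    using presentation_congruence_context[OF assms(2), of u' "[]"]
      presentation_congruence_in_lists[OF assms(1)] by simp
  ultimately show ?thesis by (rule presentation_congruence.trans)
qed

lemma presented_monoid_mult:
  assumes "u \<in> lists X" "v \<in> lists X"
  shows "presentation_congruence X R `` {u} \<otimes>\<^bsub>presented_monoid X R\<^esub> presentation_congruence X R `` {v}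
    = presentation_congruence X R `` {u @ v}"
proof -
  have eq: "presentation_congruence X R `` {u' @ v'} = presentation_congruence X R `` {u @ v}"
    if "(u, u') \<in> presentation_congruence X R" "(v, v') \<in> presentation_congruence X R" for u' v'
    by (rule equiv_class_eq[OF equiv_presentation_congruence, symmetric])
      (rule presentation_congruence_append[OF that])
  have "(u, u) \<in> presentation_congruence X R" "(v, v) \<in> presentation_congruence X R"
    using assms by (auto intro: presentation_congruence.refl)
  moreover have "(\<Union>u'\<in>presentation_congruence X R `` {u}. \<Union>v'\<in>presentation_congruence X R `` {v}.
      presentation_congruence X R `` {u' @ v'}) =
    (\<Union>u'\<in>presentation_congruence X R `` {u}. \<Union>v'\<in>presentation_congruence X R `` {v}.
      presentation_congruence X R `` {u @ v})"
    by (intro SUP_cong HOL.refl eq) (simp_all only: Image_singleton_iff)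
  ultimately show ?thesis
    unfolding presented_monoid_def by (simp only: monoid.simps) blast
qed

lemma monoid_presented_monoid: "monoid (presented_monoid X R)"
proof
  have carrierE: "\<exists>u\<in>lists X. U = presentation_congruence X R `` {u}"
    if "U \<in> carrier (presented_monoid X R)" for U
    using that by (auto simp: presented_monoid_def elim!: quotientE)
  have cls: "presentation_congruence X R `` {u} \<in> carrier (presented_monoid X R)"
    if "u \<in> lists X" for u
    using that by (auto simp: presented_monoid_def intro: quotientI)
  have one: "\<one>\<^bsub>presented_monoid X R\<^esub> = presentation_congruence X R `` {[]}"
    by (simp add: presented_monoid_def)
  show "\<one>\<^bsub>presented_monoid X R\<^esub> \<in> carrier (presented_monoid X R)"
    by (simp add: one cls)
  fix U assume "U \<in> carrier (presented_monoid X R)"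
  then obtain u where u: "u \<in> lists X" "U = presentation_congruence X R `` {u}"
    using carrierE by blast
  show "\<one>\<^bsub>presented_monoid X R\<^esub> \<otimes>\<^bsub>presented_monoid X R\<^esub> U = U"
    using u by (simp add: one presented_monoid_mult)
  show "U \<otimes>\<^bsub>presented_monoid X R\<^esub> \<one>\<^bsub>presented_monoid X R\<^esub> = U"
    using u by (simp add: one presented_monoid_mult)
  fix V assume "V \<in> carrier (presented_monoid X R)"
  then obtain v where v: "v \<in> lists X" "V = presentation_congruence X R `` {v}"
    using carrierE by blast
  show "U \<otimes>\<^bsub>presented_monoid X R\<^esub> V \<in> carrier (presented_monoid X R)"
    using u v by (simp add: presented_monoid_mult cls)
  fix W assume "W \<in> carrier (presented_monoid X R)"
  then obtain w where w: "w \<in> lists X" "W = presentation_congruence X R `` {w}"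
    using carrierE by blast
  show "U \<otimes>\<^bsub>presented_monoid X R\<^esub> V \<otimes>\<^bsub>presented_monoid X R\<^esub> W =
    U \<otimes>\<^bsub>presented_monoid X R\<^esub> (V \<otimes>\<^bsub>presented_monoid X R\<^esub> W)"
    using u v w by (simp add: presented_monoid_mult)
qed

corollary monoid_free_regular_star_monoid: "monoid (free_regular_star_monoid A)"
  by (simp add: free_regular_star_monoid_def monoid_presented_monoid)

lemma frag_extend_add_fun:
  "frag_extend (\<lambda>a. f a + g a) x = frag_extend f x + frag_extend g x"
  by (simp add: frag_extend_def frag_cmul_distrib2 sum.distrib)

lemma frag_extend_diff_fun:
  "frag_extend (\<lambda>a. f a - g a) x = frag_extend f x - frag_extend g x"
  using frag_extend_add_fun[of "\<lambda>a. f a - g a" g x] by (simp add: algebra_simps)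

lemma frag_extend_frag_extend:
  "frag_extend f (frag_extend g x) = frag_extend (\<lambda>a. frag_extend f (g a)) x"
  using subset_UNIV
  by (induction x rule: frag_induction) (auto simp: frag_extend_diff)

lemma ring_monoid_ring:
  assumes "monoid M"
  shows "ring (monoid_ring M)"
proof -
  interpret M: monoid M by fact
  define prod where "prod = (\<lambda>x y. frag_extend (\<lambda>a. frag_extend (\<lambda>b. frag_of (a \<otimes>\<^bsub>M\<^esub> b)) y) x)"
  have keys_prod: "Poly_Mapping.keys (prod x y) \<subseteq> carrier M"
    if "Poly_Mapping.keys x \<subseteq> carrier M" "Poly_Mapping.keys y \<subseteq> carrier M" for x y
  proof -
    have "Poly_Mapping.keys (prod x y) \<subseteq>
        (\<Union>a\<in>Poly_Mapping.keys x. \<Union>b\<in>Poly_Mapping.keys y. Poly_Mapping.keys (frag_of (a \<otimes>\<^bsub>M\<^esub> b)))"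
      unfolding prod_def
      by (rule order_trans[OF keys_frag_extend]) (intro UN_mono order_refl keys_frag_extend)
    also have "\<dots> \<subseteq> carrier M" using that by auto
    finally show ?thesis .
  qed
  have prod_l_distr: "prod (x + y) z = prod x z + prod y z" for x y z
    by (simp add: prod_def frag_extend_add)
  have prod_r_distr: "prod z (x + y) = prod z x + prod z y" for x y z
    by (simp add: prod_def frag_extend_add frag_extend_add_fun)
  have prod_diff: "prod (x - y) z = prod x z - prod y z" for x y z
    by (simp add: prod_def frag_extend_diff)
  have prod_diff': "prod z (x - y) = prod z x - prod z y" for x y z
    by (simp add: prod_def frag_extend_diff frag_extend_diff_fun)
  have prod_zero: "prod 0 x = 0" "prod x 0 = 0" for x
    by (simp_all add: prod_def frag_extend_eq_0)
  have prod_of: "prod (frag_of a) (frag_of b) = frag_of (a \<otimes>\<^bsub>M\<^esub> b)" for a b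
    by (simp add: prod_def)
  have assoc: "prod (prod x y) z = prod x (prod y z)"
    if x: "Poly_Mapping.keys x \<subseteq> carrier M" and y: "Poly_Mapping.keys y \<subseteq> carrier M"
      and z: "Poly_Mapping.keys z \<subseteq> carrier M" for x y z
    using x
  proof (induction x rule: frag_induction)
    case (one a)
    show ?case using y
    proof (induction y rule: frag_induction)
      case b: (one b)
      show ?case using z
        by (induction z rule: frag_induction)
          (simp_all add: prod_zero prod_diff' prod_of M.m_assoc one b)
    qed (simp_all add: prod_zero prod_diff prod_diff')
  qed (simp_all add: prod_zero prod_diff)
  have l_one: "prod (frag_of \<one>\<^bsub>M\<^esub>) x = x" if "Poly_Mapping.keys x \<subseteq> carrier M" for x
    using that by (induction x rule: frag_induction) (simp_all add: prod_zero prod_diff' prod_of)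
  have r_one: "prod x (frag_of \<one>\<^bsub>M\<^esub>) = x" if "Poly_Mapping.keys x \<subseteq> carrier M" for x
    using that by (induction x rule: frag_induction) (simp_all add: prod_zero prod_diff prod_of)
  have eq: "monoid_ring M = \<lparr>carrier = {c. Poly_Mapping.keys c \<subseteq> carrier M}, mult = prod,
      one = frag_of \<one>\<^bsub>M\<^esub>, zero = 0, add = (+)\<rparr>"
    by (simp add: monoid_ring_def prod_def)
  show ?thesis
  proof (intro ringI abelian_groupI monoidI)
    fix x assume "x \<in> carrier (monoid_ring M)"
    then show "\<exists>y\<in>carrier (monoid_ring M). y \<oplus>\<^bsub>monoid_ring M\<^esub> x = \<zero>\<^bsub>monoid_ring M\<^esub>"
      by (intro bexI[of _ "- x"]) (auto simp: eq)
  qed (use keys_prod in \<open>auto simp: eq assoc l_one r_one prod_l_distr prod_r_distr add.assoc add.commute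
        dest!: subsetD[OF Poly_Mapping.keys_add]\<close>)
qed

lemma left_module_trivial_module:
  assumes "monoid M"
  shows "left_module (monoid_ring M) (trivial_module M)"
proof -
  interpret R: ring "monoid_ring M" by (rule ring_monoid_ring[OF assms])
  define aug :: "('a \<Rightarrow>\<^sub>0 int) \<Rightarrow> int"
    where "aug c = (\<Sum>m\<in>Poly_Mapping.keys c. Poly_Mapping.lookup c m)" for c
  have aug_lookup: "aug c = Poly_Mapping.lookup (frag_extend (\<lambda>_. frag_of ()) c) ()" for c
    by (simp add: aug_def frag_extend_def lookup_sum)
  have aug_add: "aug (x + y) = aug x + aug y" and aug_diff: "aug (x - y) = aug x - aug y" for x y
    by (simp_all add: aug_lookup frag_extend_add frag_extend_diff lookup_add lookup_minus)
  have aug_of: "aug (frag_of a) = 1" for a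
    by (simp add: aug_lookup)
  have aug_0: "aug 0 = 0"
    by (simp add: aug_def)
  have aug_mult: "aug (x \<otimes>\<^bsub>monoid_ring M\<^esub> y) = aug x * aug y" for x y
    using subset_UNIV
  proof (induction x rule: frag_induction)
    case (one a)
    have "aug (frag_extend (\<lambda>b. frag_of (a \<otimes>\<^bsub>M\<^esub> b)) y) = aug y"
      using subset_UNIV
      by (induction y rule: frag_induction) (simp_all add: aug_0 aug_of aug_diff frag_extend_diff)
    then show ?case by (simp add: monoid_ring_def aug_of)
  qed (simp_all add: monoid_ring_def aug_0 aug_diff frag_extend_diff left_diff_distrib)
  have "abelian_group (trivial_module M)"
    by (intro abelian_groupI) (auto simp: trivial_module_def intro: exI[of _ "- x" for x])
  moreover have smult: "smult (trivial_module M) = (\<lambda>c k. aug c * k)"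
    by (simp add: trivial_module_def aug_def)
  moreover have "add (trivial_module M) = (+)" "carrier (trivial_module M) = UNIV"
    by (simp_all add: trivial_module_def)
  moreover have "add (monoid_ring M) = (+)" "one (monoid_ring M) = frag_of \<one>\<^bsub>M\<^esub>"
    by (simp_all add: monoid_ring_def)
  ultimately show ?thesis
    by (intro left_module.intro R.ring_axioms left_module_axioms.intro)
      (simp_all add: aug_add aug_mult aug_of algebra_simps)
qed

lemma left_module_homD:
  assumes "f \<in> left_module_hom R M N"
  shows "x \<in> carrier M \<Longrightarrow> f x \<in> carrier N"
    and "\<lbrakk>x \<in> carrier M; y \<in> carrier M\<rbrakk> \<Longrightarrow> f (x \<oplus>\<^bsub>M\<^esub> y) = f x \<oplus>\<^bsub>N\<^esub> f y"
    and "\<lbrakk>a \<in> carrier R; x \<in> carrier M\<rbrakk> \<Longrightarrow> f (a \<odot>\<^bsub>M\<^esub> x) = a \<odot>\<^bsub>N\<^esub> f x"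
  using assms by (auto simp: left_module_hom_def)

lemma (in left_module) smult_l_null [simp]:
  assumes "x \<in> carrier M"
  shows "\<zero>\<^bsub>R\<^esub> \<odot>\<^bsub>M\<^esub> x = \<zero>\<^bsub>M\<^esub>"
proof -
  have "\<zero>\<^bsub>R\<^esub> \<odot>\<^bsub>M\<^esub> x \<oplus>\<^bsub>M\<^esub> \<zero>\<^bsub>R\<^esub> \<odot>\<^bsub>M\<^esub> x = \<zero>\<^bsub>R\<^esub> \<odot>\<^bsub>M\<^esub> x"
    using smult_l_distr[of "\<zero>\<^bsub>R\<^esub>" "\<zero>\<^bsub>R\<^esub>" x] assms by simp
  then show ?thesis using assms by (metis M.add.r_cancel_one' R.zero_closed smult_closed)
qed

lemma (in left_module) smult_r_null [simp]:
  assumes "a \<in> carrier R"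
  shows "a \<odot>\<^bsub>M\<^esub> \<zero>\<^bsub>M\<^esub> = \<zero>\<^bsub>M\<^esub>"
proof -
  have "a \<odot>\<^bsub>M\<^esub> \<zero>\<^bsub>M\<^esub> \<oplus>\<^bsub>M\<^esub> a \<odot>\<^bsub>M\<^esub> \<zero>\<^bsub>M\<^esub> = a \<odot>\<^bsub>M\<^esub> \<zero>\<^bsub>M\<^esub>"
    using smult_r_distr[of a "\<zero>\<^bsub>M\<^esub>" "\<zero>\<^bsub>M\<^esub>"] assms by simp
  then show ?thesis using assms by (metis M.add.r_cancel_one' M.zero_closed smult_closed)
qed

lemma left_module_hom_zero:
  assumes "f \<in> left_module_hom R M N" "left_module R M" "left_module R N"
  shows "f \<zero>\<^bsub>M\<^esub> = \<zero>\<^bsub>N\<^esub>"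
proof -
  interpret M: left_module R M by fact
  interpret N: left_module R N by fact
  have "f (\<zero>\<^bsub>R\<^esub> \<odot>\<^bsub>M\<^esub> \<zero>\<^bsub>M\<^esub>) = \<zero>\<^bsub>R\<^esub> \<odot>\<^bsub>N\<^esub> f \<zero>\<^bsub>M\<^esub>"
    by (rule left_module_homD(3)[OF assms(1)]) simp_all
  then show ?thesis using left_module_homD(1)[OF assms(1), of "\<zero>\<^bsub>M\<^esub>"] by simp
qed

lemma left_module_hom_comp:
  assumes "f \<in> left_module_hom R L M" "g \<in> left_module_hom R M N"
  shows "g \<circ> f \<in> left_module_hom R L N"
  using assms by (auto simp: left_module_hom_def Pi_iff)

definition free_left_module :: "('r, 'x) ring_scheme \<Rightarrow> 'b set \<Rightarrow> ('r, 'b \<Rightarrow> 'r) module"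
  where "free_left_module R X =
    \<lparr>carrier = {f. range f \<subseteq> carrier R \<and> finite {x. f x \<noteq> \<zero>\<^bsub>R\<^esub>} \<and> {x. f x \<noteq> \<zero>\<^bsub>R\<^esub>} \<subseteq> X},
     mult = undefined, one = undefined,
     zero = (\<lambda>_. \<zero>\<^bsub>R\<^esub>), add = (\<lambda>f g x. f x \<oplus>\<^bsub>R\<^esub> g x),
     smult = (\<lambda>a f x. a \<otimes>\<^bsub>R\<^esub> f x)\<rparr>"

definition linear_extension ::
  "('r, 'x) ring_scheme \<Rightarrow> ('r, 'b, 'y) module_scheme \<Rightarrow> ('c \<Rightarrow> 'b) \<Rightarrow> ('c \<Rightarrow> 'r) \<Rightarrow> 'b"
  where "linear_extension R N v f = (\<Oplus>\<^bsub>N\<^esub>x\<in>{x. f x \<noteq> \<zero>\<^bsub>R\<^esub>}. f x \<odot>\<^bsub>N\<^esub> v x)"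

lemma left_module_free_left_module:
  assumes "ring R"
  shows "left_module R (free_left_module R X)"
proof -
  interpret ring R by fact
  let ?supp = "\<lambda>f. {x. f x \<noteq> \<zero>\<^bsub>R\<^esub>}"
  have add: "(\<lambda>x. f x \<oplus>\<^bsub>R\<^esub> g x) \<in> carrier (free_left_module R X)"
    if "f \<in> carrier (free_left_module R X)" "g \<in> carrier (free_left_module R X)" for f g
  proof -
    have "?supp (\<lambda>x. f x \<oplus>\<^bsub>R\<^esub> g x) \<subseteq> ?supp f \<union> ?supp g" by auto
    with that show ?thesis
      by (auto simp: free_left_module_def image_subset_iff
          intro: finite_subset[of _ "?supp f \<union> ?supp g"])
  qed
  have smult: "(\<lambda>x. a \<otimes>\<^bsub>R\<^esub> f x) \<in> carrier (free_left_module R X)"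
    if "a \<in> carrier R" "f \<in> carrier (free_left_module R X)" for a f
  proof -
    have "?supp (\<lambda>x. a \<otimes>\<^bsub>R\<^esub> f x) \<subseteq> ?supp f" using that(1) by auto
    with that show ?thesis
      by (auto simp: free_left_module_def image_subset_iff intro: finite_subset[of _ "?supp f"])
  qed
  have val: "f x \<in> carrier R" if "f \<in> carrier (free_left_module R X)" for f x
    using that by (auto simp: free_left_module_def)
  have ops: "f \<oplus>\<^bsub>free_left_module R X\<^esub> g = (\<lambda>x. f x \<oplus>\<^bsub>R\<^esub> g x)"
    "a \<odot>\<^bsub>free_left_module R X\<^esub> f = (\<lambda>x. a \<otimes>\<^bsub>R\<^esub> f x)"
    "\<zero>\<^bsub>free_left_module R X\<^esub> = (\<lambda>_. \<zero>\<^bsub>R\<^esub>)" for f g a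
    by (simp_all add: free_left_module_def)
  have "abelian_group (free_left_module R X)"
  proof (rule abelian_groupI)
    fix f assume f: "f \<in> carrier (free_left_module R X)"
    have "(\<lambda>x. (\<ominus>\<^bsub>R\<^esub> \<one>\<^bsub>R\<^esub>) \<otimes>\<^bsub>R\<^esub> f x) \<in> carrier (free_left_module R X)"
      using f by (intro smult) auto
    then show "\<exists>g\<in>carrier (free_left_module R X).
        g \<oplus>\<^bsub>free_left_module R X\<^esub> f = \<zero>\<^bsub>free_left_module R X\<^esub>"
      by (rule bexI[rotated]) (simp add: ops val[OF f] l_minus l_neg)
  qed (auto simp: ops add val a_ac, simp add: free_left_module_def)
  then show ?thesis
    by (intro left_module.intro left_module_axioms.intro ring_axioms)
      (auto simp: ops smult val l_distr r_distr m_assoc)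
qed

lemma linear_extension_superset:
  assumes "left_module R N" "v \<in> X \<rightarrow> carrier N" "f \<in> carrier (free_left_module R X)"
    "finite S" "{x. f x \<noteq> \<zero>\<^bsub>R\<^esub>} \<subseteq> S" "S \<subseteq> X"
  shows "linear_extension R N v f = (\<Oplus>\<^bsub>N\<^esub>x\<in>S. f x \<odot>\<^bsub>N\<^esub> v x)"
proof -
  interpret N: left_module R N by fact
  show ?thesis
    unfolding linear_extension_def
    using assms by (intro N.add.finprod_mono_neutral_cong_left)
      (auto simp: free_left_module_def Pi_iff subset_iff)
qed

lemma linear_extension_hom:
  fixes v :: "'c \<Rightarrow> 'b"
  assumes "left_module R N" "v \<in> X \<rightarrow> carrier N"
  shows "linear_extension R N v \<in> left_module_hom R (free_left_module R X) N"
proof -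
  interpret N: left_module R N by fact
  let ?F = "free_left_module R X"
  let ?supp = "\<lambda>f. {x. f x \<noteq> \<zero>\<^bsub>R\<^esub>}"
  interpret F: left_module R ?F by (rule left_module_free_left_module) (rule N.R.ring_axioms)
  have val: "f x \<in> carrier R" if "f \<in> carrier ?F" for f x
    using that by (auto simp: free_left_module_def)
  have supp: "finite (?supp f)" "?supp f \<subseteq> X" if "f \<in> carrier ?F" for f
    using that by (auto simp: free_left_module_def)
  have ops: "f \<oplus>\<^bsub>?F\<^esub> g = (\<lambda>x. f x \<oplus>\<^bsub>R\<^esub> g x)" "a \<odot>\<^bsub>?F\<^esub> f = (\<lambda>x. a \<otimes>\<^bsub>R\<^esub> f x)" for f g a
    by (simp_all add: free_left_module_def)
  have v: "v x \<in> carrier N" if "x \<in> X" for x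
    using assms(2) that by auto
  have closed: "linear_extension R N v f \<in> carrier N" if "f \<in> carrier ?F" for f
    unfolding linear_extension_def using supp[OF that] val[OF that] v
    by (intro N.M.finsum_closed) auto
  have add: "linear_extension R N v (f \<oplus>\<^bsub>?F\<^esub> g)
      = linear_extension R N v f \<oplus>\<^bsub>N\<^esub> linear_extension R N v g"
    if f: "f \<in> carrier ?F" and g: "g \<in> carrier ?F" for f g
  proof -
    let ?S = "?supp f \<union> ?supp g"
    have S: "finite ?S" "?S \<subseteq> X" using supp[OF f] supp[OF g] by auto
    have "linear_extension R N v (f \<oplus>\<^bsub>?F\<^esub> g) = (\<Oplus>\<^bsub>N\<^esub>x\<in>?S. (f \<oplus>\<^bsub>?F\<^esub> g) x \<odot>\<^bsub>N\<^esub> v x)"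
      by (rule linear_extension_superset[OF assms F.M.a_closed[OF f g] S(1) _ S(2)])
        (auto simp: ops)
    also have "\<dots> = (\<Oplus>\<^bsub>N\<^esub>x\<in>?S. f x \<odot>\<^bsub>N\<^esub> v x \<oplus>\<^bsub>N\<^esub> g x \<odot>\<^bsub>N\<^esub> v x)"
      using S val[OF f] val[OF g] v
      by (intro N.M.finsum_cong') (auto simp: ops N.smult_l_distr)
    also have "\<dots> = (\<Oplus>\<^bsub>N\<^esub>x\<in>?S. f x \<odot>\<^bsub>N\<^esub> v x) \<oplus>\<^bsub>N\<^esub> (\<Oplus>\<^bsub>N\<^esub>x\<in>?S. g x \<odot>\<^bsub>N\<^esub> v x)"
      using S val[OF f] val[OF g] v by (intro N.M.finsum_addf) auto
    also have "(\<Oplus>\<^bsub>N\<^esub>x\<in>?S. f x \<odot>\<^bsub>N\<^esub> v x) = linear_extension R N v f"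
      by (rule linear_extension_superset[OF assms f S(1) _ S(2), symmetric]) auto
    also have "(\<Oplus>\<^bsub>N\<^esub>x\<in>?S. g x \<odot>\<^bsub>N\<^esub> v x) = linear_extension R N v g"
      by (rule linear_extension_superset[OF assms g S(1) _ S(2), symmetric]) auto
    finally show ?thesis .
  qed
  have finsum_smult: "a \<odot>\<^bsub>N\<^esub> (\<Oplus>\<^bsub>N\<^esub>x\<in>S. t x) = (\<Oplus>\<^bsub>N\<^esub>x\<in>S. a \<odot>\<^bsub>N\<^esub> t x)"
    if "finite S" "t \<in> S \<rightarrow> carrier N" "a \<in> carrier R" for a t and S :: "'c set"
    using that
  proof (induction S)
    case (insert s S)
    then have "t s \<in> carrier N" "t \<in> S \<rightarrow> carrier N" by auto
    with insert show ?case by (auto simp: N.smult_r_distr Pi_iff)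
  qed simp
  have smult: "linear_extension R N v (a \<odot>\<^bsub>?F\<^esub> f) = a \<odot>\<^bsub>N\<^esub> linear_extension R N v f"
    if a: "a \<in> carrier R" and f: "f \<in> carrier ?F" for a f
  proof -
    have "linear_extension R N v (a \<odot>\<^bsub>?F\<^esub> f) = (\<Oplus>\<^bsub>N\<^esub>x\<in>?supp f. (a \<odot>\<^bsub>?F\<^esub> f) x \<odot>\<^bsub>N\<^esub> v x)"
      using a by (intro linear_extension_superset[OF assms F.smult_closed[OF a f] supp(1)[OF f] _ supp(2)[OF f]])
        (auto simp: ops)
    also have "\<dots> = (\<Oplus>\<^bsub>N\<^esub>x\<in>?supp f. a \<odot>\<^bsub>N\<^esub> (f x \<odot>\<^bsub>N\<^esub> v x))"
      using supp[OF f] val[OF f] v a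
      by (intro N.M.finsum_cong') (auto simp: ops N.smult_assoc1)
    also have "\<dots> = a \<odot>\<^bsub>N\<^esub> linear_extension R N v f"
      unfolding linear_extension_def
      using supp[OF f] val[OF f] v a by (intro finsum_smult[symmetric]) auto
    finally show ?thesis .
  qed
  show ?thesis
    using closed add smult by (auto simp: left_module_hom_def)
qed

lemma hom_linear_extension:
  assumes "left_module R N" "left_module R N'" "g \<in> left_module_hom R N N'"
    and v: "v \<in> X \<rightarrow> carrier N" and f: "f \<in> carrier (free_left_module R X)"
  shows "g (linear_extension R N v f) = linear_extension R N' (g \<circ> v) f"
proof -
  interpret N: left_module R N by fact
  interpret N': left_module R N' by fact
  note g = left_module_homD[OF assms(3)]
  have val: "f x \<in> carrier R" for x
    using f by (auto simp: free_left_module_def)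
  have *: "g (\<Oplus>\<^bsub>N\<^esub>x\<in>S. f x \<odot>\<^bsub>N\<^esub> v x) = (\<Oplus>\<^bsub>N'\<^esub>x\<in>S. f x \<odot>\<^bsub>N'\<^esub> (g \<circ> v) x)"
    if "finite S" "S \<subseteq> X" for S
    using that
  proof (induction S)
    case empty
    then show ?case using left_module_hom_zero[OF assms(3,1,2)] by simp
  next
    case (insert s S)
    have v': "v x \<in> carrier N" if "x \<in> insert s S" for x
      using v that insert.prems by auto
    with insert show ?case
      by (simp add: g val Pi_iff)
  qed
  show ?thesis
    using f unfolding linear_extension_def by (intro *) (auto simp: free_left_module_def)
qed

theorem projective_module_lift:
  fixes P :: "('r, 'b) module" and N :: "('r, 'c) module" and N' :: "('r, 'd) module"
  assumes P: "projective_module R P" and N: "left_module R N" and N': "left_module R N'"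
    and g: "g \<in> left_module_hom R N N'" "g ` carrier N = carrier N'"
    and h: "h \<in> left_module_hom R P N'"
  shows "\<exists>k \<in> left_module_hom R P N. \<forall>x\<in>carrier P. g (k x) = h x"
proof -
  interpret P: left_module R P using P by (simp add: projective_module_def)
  let ?F = "free_left_module R (carrier P)"
  have F: "left_module R ?F" by (rule left_module_free_left_module) (rule P.R.ring_axioms)
  have id: "(\<lambda>x. x) \<in> carrier P \<rightarrow> carrier P" by simp
  have pi: "linear_extension R P (\<lambda>x. x) \<in> left_module_hom R ?F P"
    by (rule linear_extension_hom[OF P.left_module_axioms id])
  have surj: "linear_extension R P (\<lambda>x. x) ` carrier ?F = carrier P"
  proof
    show "linear_extension R P (\<lambda>x. x) ` carrier ?F \<subseteq> carrier P"
      using left_module_homD(1)[OF pi] by auto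
    show "carrier P \<subseteq> linear_extension R P (\<lambda>x. x) ` carrier ?F"
    proof
      fix p assume p: "p \<in> carrier P"
      define f where "f = (\<lambda>x. if x = p then \<one>\<^bsub>R\<^esub> else \<zero>\<^bsub>R\<^esub>)"
      have f: "f \<in> carrier ?F"
        using p by (auto simp: f_def free_left_module_def intro: finite_subset[of _ "{p}"])
      have "linear_extension R P (\<lambda>x. x) f = (\<Oplus>\<^bsub>P\<^esub>x\<in>{p}. f x \<odot>\<^bsub>P\<^esub> x)"
        using p by (intro linear_extension_superset[OF P.left_module_axioms id f]) (auto simp: f_def)
      also have "\<dots> = p" using p by (simp add: f_def)
      finally show "p \<in> linear_extension R P (\<lambda>x. x) ` carrier ?F" using f by force
    qed
  qed
  have "(\<lambda>x. x) \<in> left_module_hom R P P" by (simp add: left_module_hom_def)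
  then obtain s where s: "s \<in> left_module_hom R P ?F"
    and s_section: "\<And>x. x \<in> carrier P \<Longrightarrow> linear_extension R P (\<lambda>x. x) (s x) = x"
    using P F P.left_module_axioms pi surj unfolding projective_module_def by meson
  have "\<forall>x\<in>carrier P. \<exists>y\<in>carrier N. g y = h x"
    using g(2) left_module_homD(1)[OF h] by (metis imageE)
  then obtain v where v: "\<And>x. x \<in> carrier P \<Longrightarrow> v x \<in> carrier N \<and> g (v x) = h x"
    by metis
  then have v': "v \<in> carrier P \<rightarrow> carrier N" by auto
  show ?thesis
  proof (intro bexI ballI)
    show "linear_extension R N v \<circ> s \<in> left_module_hom R P N"
      using left_module_hom_comp[OF s linear_extension_hom[OF N v']] .
    fix x assume x: "x \<in> carrier P"
    then have sx: "s x \<in> carrier ?F" using left_module_homD(1)[OF s] by auto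
    interpret N': left_module R N' by (rule N')
    have "g (linear_extension R N v (s x)) = linear_extension R N' (g \<circ> v) (s x)"
      by (rule hom_linear_extension[OF N N' g(1) v' sx])
    also have "\<dots> = linear_extension R N' (h \<circ> (\<lambda>x. x)) (s x)"
      unfolding linear_extension_def
      using sx v left_module_homD(1)[OF h]
      by (intro N'.M.finsum_cong') (auto simp: free_left_module_def subset_iff)
    also have "\<dots> = h (linear_extension R P (\<lambda>x. x) (s x))"
      by (rule hom_linear_extension[OF P.left_module_axioms N' h id sx, symmetric])
    also have "\<dots> = h x" using s_section[OF x] by simp
    finally show "g ((linear_extension R N v \<circ> s) x) = h x" by simp
  qed
qed

end

theory Submission
  imports Defs
begin

text \<open>Let \<open>F = free_regular_star_monoid A\<close>, let \<open>X\<close> be the set of letters, and let \<open>\<Gamma>\<close> be the right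
  Cayley graph of \<open>F\<close>, on which \<open>F\<close> acts from the left. The cellular chain complex of \<open>\<Gamma>\<close> is the
  start \<open>(ZF)\<^sup>X \<rightarrow> ZF \<rightarrow> Z\<close> of a free resolution. By a Schanuel argument
  (\<open>kernel_finitely_generated\<close>), if \<open>F\<close> were of type \<open>FP\<^sub>2\<close>, then the cycles of \<open>\<Gamma>\<close> would be
  generated, as a left \<open>ZF\<close>-module, by a finite set \<open>S\<close>.

  Sending each \<open>a \<in> A\<close> to \<open>1\<close> and each \<open>a\<^sup>\<star>\<close> to \<open>-1\<close> defines a homomorphism \<open>h : F \<rightarrow> Z\<close>, the height.
  The vertices of a cycle in \<open>S\<close> have heights in some interval \<open>[-B, B]\<close>, so each translate of such a
  cycle stays in a band of heights of width \<open>2B\<close>. Suppose that \<open>C\<close> is a set of vertices such that all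
  edges that leave \<open>C\<close> start at height \<open>lo\<close>, and all edges that enter \<open>C\<close> start at height \<open>hi\<close>, with
  \<open>hi - lo > 2B\<close>. A translate of an element of \<open>S\<close> cannot meet edges of both kinds; but a cycle enters
  \<open>C\<close> as often as it leaves it, so its number of exits is zero. Counting exits is additive, hence no
  cycle of \<open>\<Gamma>\<close> has a nonzero number of exits. This contradicts the existence of a closed path
  that leaves \<open>C\<close> and comes back (\<open>not_type_FP2_if_distant_cuts\<close>).

  Such sets \<open>C\<close> come from hysteresis. Let a point walk on \<open>Z\<close> as dictated by a word, and keep a flag
  that is switched on whenever the point arrives at a height \<open>\<ge> N\<close>, is switched off whenever it
  arrives at a height \<open>\<le> 0\<close>, and is kept otherwise. The words \<open>w w\<^sup>\<star> w\<close> and \<open>w\<close> have the same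
  effect (\<open>hysteresis_return\<close>): counting the starting point, the zone visited last is the same for
  both. So the flag is a function on \<open>F\<close>. Let \<open>C\<close> consist of the elements with flag on. The flag can only go
  off in a step from \<open>1\<close> to \<open>0\<close>, and on in a step from \<open>N - 1\<close> to \<open>N\<close>, while \<open>N\<close> is arbitrary. Since
  \<open>a\<^sup>N (a\<^sup>\<star>)\<^sup>N a\<^sup>N = a\<^sup>N\<close>, the path from \<open>a\<^sup>N\<close> labelled \<open>(a\<^sup>\<star>)\<^sup>N a\<^sup>N\<close> is closed, and it leaves \<open>C\<close>
  and returns.\<close>


section \<open>Kernels of module homomorphisms\<close>

lemma left_module_hom_minus:
  assumes f: "f \<in> left_module_hom R M N" and g: "g \<in> left_module_hom R M N"
    and M: "left_module R M" and N: "left_module R N"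
  shows "(\<lambda>x. f x \<ominus>\<^bsub>N\<^esub> g x) \<in> left_module_hom R M N"
proof -
  interpret M: left_module R M by fact
  interpret N: left_module R N by fact
  note f' = left_module_homD[OF f] and g' = left_module_homD[OF g]
  have neg: "\<ominus>\<^bsub>N\<^esub> (a \<odot>\<^bsub>N\<^esub> x) = a \<odot>\<^bsub>N\<^esub> (\<ominus>\<^bsub>N\<^esub> x)" if "a \<in> carrier R" "x \<in> carrier N" for a x
    using that N.smult_r_distr[of a x "\<ominus>\<^bsub>N\<^esub> x"]
    by (intro N.minus_equality) (simp_all add: N.M.r_neg N.M.a_comm)
  show ?thesis
    unfolding left_module_hom_def
    using f' g'
    by (auto simp: N.M.minus_eq neg N.smult_r_distr N.M.minus_add N.M.a_ac)
qed

lemma left_module_hom_diff: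
  assumes f: "f \<in> left_module_hom R M N" and M: "left_module R M" and N: "left_module R N"
    and x: "x \<in> carrier M" "y \<in> carrier M"
  shows "f (x \<ominus>\<^bsub>M\<^esub> y) = f x \<ominus>\<^bsub>N\<^esub> f y"
proof -
  interpret M: left_module R M by fact
  interpret N: left_module R N by fact
  note f' = left_module_homD[OF f]
  have "f (\<ominus>\<^bsub>M\<^esub> y) \<oplus>\<^bsub>N\<^esub> f y = f (\<ominus>\<^bsub>M\<^esub> y \<oplus>\<^bsub>M\<^esub> y)"
    using x f' by simp
  also have "\<dots> = \<zero>\<^bsub>N\<^esub>"
    using x left_module_hom_zero[OF f M N] by (simp add: M.M.l_neg)
  finally have "\<ominus>\<^bsub>N\<^esub> f y = f (\<ominus>\<^bsub>M\<^esub> y)"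
    using x f' by (intro N.minus_equality) simp_all
  then show ?thesis
    using x f' by (simp add: M.M.minus_eq N.M.minus_eq)
qed

lemma submodule_vimage:
  assumes f: "f \<in> left_module_hom R M N" and M: "left_module R M" and N: "left_module R N"
    and H: "submodule H R N"
  shows "submodule {x \<in> carrier M. f x \<in> H} R M"
proof -
  interpret M: left_module R M by fact
  interpret N: left_module R N by fact
  interpret H: submodule H R N by fact
  note f' = left_module_homD[OF f]
  have neg: "f (\<ominus>\<^bsub>M\<^esub> x) = \<ominus>\<^bsub>N\<^esub> f x" if "x \<in> carrier M" for x
    using left_module_hom_diff[OF f M N M.M.zero_closed that] left_module_hom_zero[OF f M N] that f'
    by (simp add: M.M.minus_eq N.M.minus_eq)
  show ?thesis
    using f' H.m_closed H.one_closed H.m_inv_closed H.smult_closed neg left_module_hom_zero[OF f M N]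
    by (intro submodule.intro subgroup.intro submodule_axioms.intro)
      (auto simp flip: a_inv_def)
qed

lemma left_module_image:
  assumes f: "f \<in> left_module_hom R M N" and M: "left_module R M" and N: "left_module R N"
  shows "left_module R (N\<lparr>carrier := f ` carrier M\<rparr>)"
proof -
  interpret M: left_module R M by fact
  interpret N: left_module R N by fact
  note f' = left_module_homD[OF f]
  have sub: "f ` carrier M \<subseteq> carrier N" using f' by auto
  have "abelian_group (N\<lparr>carrier := f ` carrier M\<rparr>)"
  proof (rule abelian_groupI, goal_cases)
    case (1 x y)
    then show ?case using M.M.a_closed by (auto simp flip: f'(2))
  next
    case 2
    show ?case using left_module_hom_zero[OF f M N] M.M.zero_closed by (auto intro: rev_image_eqI)
  next
    case (6 x)
    then obtain y where y: "y \<in> carrier M" "x = f y" by auto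
    have "f (\<ominus>\<^bsub>M\<^esub> y) \<oplus>\<^bsub>N\<^esub> f y = \<zero>\<^bsub>N\<^esub>"
      using y left_module_hom_zero[OF f M N] by (simp add: M.M.l_neg flip: f'(2))
    then show ?case using y by auto
  qed (use sub in \<open>auto simp: subset_iff N.M.a_ac\<close>)
  then show ?thesis
    using sub
    by (intro left_module.intro left_module_axioms.intro M.R.ring_axioms)
      (auto simp: subset_iff N.smult_l_distr N.smult_r_distr N.smult_assoc1 simp flip: f'(2,3))
qed

text \<open>The image of \<open>g\<close> is itself a module, and \<open>g\<close> is a surjection onto it. This is how exactness of
  a resolution enters.\<close>

lemma projective_module_lift_image:
  fixes P :: "('r, 'b) module" and N :: "('r, 'c) module" and L :: "('r, 'd) module"
  assumes P: "projective_module R P" and N: "left_module R N" and L: "left_module R L"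
    and g: "g \<in> left_module_hom R N L" and h: "h \<in> left_module_hom R P L"
    and sub: "h ` carrier P \<subseteq> g ` carrier N"
  obtains k where "k \<in> left_module_hom R P N" "\<And>x. x \<in> carrier P \<Longrightarrow> g (k x) = h x"
proof -
  let ?I = "L\<lparr>carrier := g ` carrier N\<rparr>"
  have "g \<in> left_module_hom R N ?I" "h \<in> left_module_hom R P ?I" "g ` carrier N = carrier ?I"
    using g h sub by (auto simp: left_module_hom_def)
  then show ?thesis
    using projective_module_lift[OF P N left_module_image[OF g N L], of g h] that by auto
qed

text \<open>As in Schanuel's lemma, finite generation passes from one projective resolution to the
  beginning \<open>Q1 \<rightarrow> Q0 \<rightarrow> Z\<close> of any other. Comparison maps \<open>\<phi>\<close> from \<open>Q\<close> to \<open>P\<close> and \<open>\<psi>\<close> back compose to something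
  homotopic to the identity of \<open>Q\<close>, say through \<open>s : Q0 \<rightarrow> Q1\<close>. So \<open>\<psi>\<^sub>1\<phi>\<^sub>1\<close> and the identity differ, on
  the kernel of \<open>D : Q1 \<rightarrow> Q0\<close>, by the map \<open>\<tau> = \<psi>\<^sub>1\<phi>\<^sub>1 - 1 - sD\<close>, all of whose values lie in that kernel.
  Hence the kernel is generated by the images of generators of \<open>P 2\<close> under \<open>\<psi>\<^sub>1 d\<^sub>1\<close> and of generators
  of \<open>Q1\<close> under \<open>\<tau>\<close>.\<close>

lemma kernel_finitely_generated:
  fixes R :: "('r, 'x) ring_scheme" and Z :: "('r, 'c) module"
    and P :: "nat \<Rightarrow> ('r, 'b) module" and Q0 :: "('r, 'd) module" and Q1 :: "('r, 'e) module"
  assumes res: "projective_resolution R Z P d e" and Z: "left_module R Z"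
    and fg2: "finitely_generated_module R (P 2)"
    and Q0: "projective_module R Q0" and Q1: "projective_module R Q1"
    and fg1: "finitely_generated_module R Q1"
    and D: "D \<in> left_module_hom R Q1 Q0" and \<epsilon>: "\<epsilon> \<in> left_module_hom R Q0 Z"
    and surj: "\<epsilon> ` carrier Q0 = carrier Z" and exact: "D ` carrier Q1 = a_kernel Q0 Z \<epsilon>"
  obtains S where "finite S" "S \<subseteq> a_kernel Q1 Q0 D"
    "\<And>H. submodule H R Q1 \<Longrightarrow> S \<subseteq> H \<Longrightarrow> a_kernel Q1 Q0 D \<subseteq> H"
proof -
  have P: "projective_module R (P i)" for i
    using res by (simp add: projective_resolution_def)
  have d: "d i \<in> left_module_hom R (P (Suc i)) (P i)" for i
    using res by (simp add: projective_resolution_def)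
  have e: "e \<in> left_module_hom R (P 0) Z" and e_surj: "e ` carrier (P 0) = carrier Z"
    and ex0: "d 0 ` carrier (P (Suc 0)) = a_kernel (P 0) Z e"
    and ex1: "d (Suc 0) ` carrier (P 2) = a_kernel (P (Suc 0)) (P 0) (d 0)"
    using res by (simp_all add: projective_resolution_def numeral_2_eq_2)
  have LP: "left_module R (P i)" and LQ0: "left_module R Q0" and LQ1: "left_module R Q1" for i
    using P Q0 Q1 by (simp_all add: projective_module_def)
  interpret Q0: left_module R Q0 by fact
  interpret Q1: left_module R Q1 by fact
  have id0: "(\<lambda>x. x) \<in> left_module_hom R Q0 Q0" and id1: "(\<lambda>x. x) \<in> left_module_hom R Q1 Q1"
    by (simp_all add: left_module_hom_def)
  note D' = left_module_homD[OF D]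

  obtain \<phi>0 where \<phi>0: "\<phi>0 \<in> left_module_hom R Q0 (P 0)"
    "\<And>x. x \<in> carrier Q0 \<Longrightarrow> e (\<phi>0 x) = \<epsilon> x"
    using projective_module_lift_image[OF Q0 LP Z e \<epsilon>] surj e_surj by blast
  note \<phi>0' = left_module_homD[OF \<phi>0(1)]
  have "\<epsilon> (D x) = \<zero>\<^bsub>Z\<^esub>" if "x \<in> carrier Q1" for x
    using exact that by (auto simp: a_kernel_def')
  then have "(\<phi>0 \<circ> D) ` carrier Q1 \<subseteq> d 0 ` carrier (P (Suc 0))"
    unfolding ex0 using D' \<phi>0 \<phi>0' by (auto simp: a_kernel_def')
  then obtain \<phi>1 where \<phi>1: "\<phi>1 \<in> left_module_hom R Q1 (P (Suc 0))"
    "\<And>x. x \<in> carrier Q1 \<Longrightarrow> d 0 (\<phi>1 x) = \<phi>0 (D x)"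
    using projective_module_lift_image[OF Q1 LP LP d left_module_hom_comp[OF D \<phi>0(1)]]
    by (auto simp: o_def)
  note \<phi>1' = left_module_homD[OF \<phi>1(1)]

  obtain \<psi>0 where \<psi>0: "\<psi>0 \<in> left_module_hom R (P 0) Q0"
    "\<And>x. x \<in> carrier (P 0) \<Longrightarrow> \<epsilon> (\<psi>0 x) = e x"
    using projective_module_lift_image[OF P LQ0 Z \<epsilon> e] surj e_surj by blast
  note \<psi>0' = left_module_homD[OF \<psi>0(1)]
  have "e (d 0 x) = \<zero>\<^bsub>Z\<^esub>" if "x \<in> carrier (P (Suc 0))" for x
    using ex0 that by (auto simp: a_kernel_def')
  then have "(\<psi>0 \<circ> d 0) ` carrier (P (Suc 0)) \<subseteq> D ` carrier Q1"
    unfolding exact using left_module_homD[OF d] \<psi>0 \<psi>0' by (auto simp: a_kernel_def')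
  then obtain \<psi>1 where \<psi>1: "\<psi>1 \<in> left_module_hom R (P (Suc 0)) Q1"
    "\<And>x. x \<in> carrier (P (Suc 0)) \<Longrightarrow> D (\<psi>1 x) = \<psi>0 (d 0 x)"
    using projective_module_lift_image[OF P LQ1 LQ0 D left_module_hom_comp[OF d \<psi>0(1)]]
    by (auto simp: o_def)
  note \<psi>1' = left_module_homD[OF \<psi>1(1)]

  have \<psi>\<phi>0: "(\<lambda>x. \<psi>0 (\<phi>0 x) \<ominus>\<^bsub>Q0\<^esub> x) \<in> left_module_hom R Q0 Q0"
    using left_module_hom_minus[OF left_module_hom_comp[OF \<phi>0(1) \<psi>0(1)] id0 LQ0 LQ0]
    by (simp add: o_def)
  have "(\<lambda>x. \<psi>0 (\<phi>0 x) \<ominus>\<^bsub>Q0\<^esub> x) ` carrier Q0 \<subseteq> D ` carrier Q1"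
  proof -
    interpret Z: left_module R Z by fact
    have "\<epsilon> (\<psi>0 (\<phi>0 x) \<ominus>\<^bsub>Q0\<^esub> x) = \<zero>\<^bsub>Z\<^esub>" if "x \<in> carrier Q0" for x
      using that \<phi>0 \<phi>0' \<psi>0 \<psi>0' left_module_homD[OF \<epsilon>]
      by (simp add: left_module_hom_diff[OF \<epsilon> LQ0 Z] Z.M.minus_eq Z.M.r_neg)
    then show ?thesis
      unfolding exact using left_module_homD[OF \<psi>\<phi>0] by (auto simp: a_kernel_def')
  qed
  then obtain s where s: "s \<in> left_module_hom R Q0 Q1"
    "\<And>x. x \<in> carrier Q0 \<Longrightarrow> D (s x) = \<psi>0 (\<phi>0 x) \<ominus>\<^bsub>Q0\<^esub> x"
    using projective_module_lift_image[OF Q0 LQ1 LQ0 D \<psi>\<phi>0] by blast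
  note s' = left_module_homD[OF s(1)]

  define \<tau> where "\<tau> = (\<lambda>x. \<psi>1 (\<phi>1 x) \<ominus>\<^bsub>Q1\<^esub> x \<ominus>\<^bsub>Q1\<^esub> s (D x))"
  have \<tau>: "\<tau> \<in> left_module_hom R Q1 Q1"
    unfolding \<tau>_def
    using left_module_hom_minus[OF left_module_hom_minus[OF left_module_hom_comp[OF \<phi>1(1) \<psi>1(1)]
          id1 LQ1 LQ1] left_module_hom_comp[OF D s(1)] LQ1 LQ1]
    by (simp add: o_def)
  note \<tau>' = left_module_homD[OF \<tau>]
  have \<tau>_ker: "\<tau> x \<in> a_kernel Q1 Q0 D" if x: "x \<in> carrier Q1" for x
  proof -
    have "D (\<tau> x) = (\<psi>0 (\<phi>0 (D x)) \<ominus>\<^bsub>Q0\<^esub> D x) \<ominus>\<^bsub>Q0\<^esub> (\<psi>0 (\<phi>0 (D x)) \<ominus>\<^bsub>Q0\<^esub> D x)"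
      unfolding \<tau>_def using x D' \<phi>1 \<phi>1' \<psi>1 \<psi>1' s s'
      by (simp add: left_module_hom_diff[OF D LQ1 LQ0] Q1.M.minus_closed)
    also have "\<dots> = \<zero>\<^bsub>Q0\<^esub>"
      using x D' \<phi>0' \<psi>0' by (simp add: Q0.M.minus_eq Q0.M.r_neg)
    finally show ?thesis using x \<tau>' by (simp add: a_kernel_def')
  qed
  have \<psi>d: "\<psi>1 \<circ> d (Suc 0) \<in> left_module_hom R (P 2) Q1"
    using left_module_hom_comp[OF d[of "Suc 0"] \<psi>1(1)] by (simp add: numeral_2_eq_2)
  have \<psi>d_ker: "(\<psi>1 \<circ> d (Suc 0)) y \<in> a_kernel Q1 Q0 D" if y: "y \<in> carrier (P 2)" for y
  proof -
    have "d (Suc 0) y \<in> a_kernel (P (Suc 0)) (P 0) (d 0)" using y ex1 by blast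
    then have dy: "d (Suc 0) y \<in> carrier (P (Suc 0))" "d 0 (d (Suc 0) y) = \<zero>\<^bsub>P 0\<^esub>"
      by (auto simp: a_kernel_def')
    then show ?thesis
      using \<psi>1 \<psi>1' left_module_hom_zero[OF \<psi>0(1) LP LQ0] by (simp add: a_kernel_def')
  qed

  obtain S1 where S1: "finite S1" "S1 \<subseteq> carrier Q1"
    "\<And>H. submodule H R Q1 \<Longrightarrow> S1 \<subseteq> H \<Longrightarrow> H = carrier Q1"
    using fg1 unfolding finitely_generated_module_def by auto
  obtain S2 where S2: "finite S2" "S2 \<subseteq> carrier (P 2)"
    "\<And>H. submodule H R (P 2) \<Longrightarrow> S2 \<subseteq> H \<Longrightarrow> H = carrier (P 2)"
    using fg2 unfolding finitely_generated_module_def by auto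
  show ?thesis
  proof (rule that)
    show "finite (\<tau> ` S1 \<union> (\<psi>1 \<circ> d (Suc 0)) ` S2)" using S1(1) S2(1) by simp
    show "\<tau> ` S1 \<union> (\<psi>1 \<circ> d (Suc 0)) ` S2 \<subseteq> a_kernel Q1 Q0 D"
      using \<tau>_ker \<psi>d_ker S1(2) S2(2) by blast
    fix H assume H: "submodule H R Q1" and sub: "\<tau> ` S1 \<union> (\<psi>1 \<circ> d (Suc 0)) ` S2 \<subseteq> H"
    interpret H: submodule H R Q1 by fact
    have "{x \<in> carrier Q1. \<tau> x \<in> H} = carrier Q1"
      using sub S1(2) by (intro S1(3) submodule_vimage[OF \<tau> LQ1 LQ1 H]) auto
    then have \<tau>H: "\<tau> x \<in> H" if "x \<in> carrier Q1" for x using that by blast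
    have "{y \<in> carrier (P 2). (\<psi>1 \<circ> d (Suc 0)) y \<in> H} = carrier (P 2)"
      using sub S2(2) by (intro S2(3) submodule_vimage[OF \<psi>d LP LQ1 H]) auto
    then have \<psi>dH: "\<psi>1 (d (Suc 0) y) \<in> H" if "y \<in> carrier (P 2)" for y using that by auto
    show "a_kernel Q1 Q0 D \<subseteq> H"
    proof
      fix z assume "z \<in> a_kernel Q1 Q0 D"
      then have z: "z \<in> carrier Q1" "D z = \<zero>\<^bsub>Q0\<^esub>" by (auto simp: a_kernel_def')
      have "\<phi>1 z \<in> a_kernel (P (Suc 0)) (P 0) (d 0)"
        using z \<phi>1 \<phi>1' left_module_hom_zero[OF \<phi>0(1) LQ0 LP] by (simp add: a_kernel_def')
      then have "\<psi>1 (\<phi>1 z) \<in> H" using \<psi>dH unfolding ex1[symmetric] by auto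
      moreover have "\<ominus>\<^bsub>Q1\<^esub> \<tau> z \<in> H"
        using H.m_inv_closed[OF \<tau>H[OF z(1)]] by (simp add: a_inv_def)
      ultimately have "\<psi>1 (\<phi>1 z) \<oplus>\<^bsub>Q1\<^esub> (\<ominus>\<^bsub>Q1\<^esub> \<tau> z) \<in> H"
        using H.m_closed by simp
      moreover have "\<psi>1 (\<phi>1 z) \<oplus>\<^bsub>Q1\<^esub> (\<ominus>\<^bsub>Q1\<^esub> \<tau> z) = z"
      proof -
        have c: "\<psi>1 (\<phi>1 z) \<in> carrier Q1" using z \<phi>1' \<psi>1' by simp
        have "\<tau> z = \<psi>1 (\<phi>1 z) \<ominus>\<^bsub>Q1\<^esub> z"
          unfolding \<tau>_def using z c left_module_hom_zero[OF s(1) LQ0 LQ1]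
          by (simp add: Q1.M.minus_eq)
        then have "\<ominus>\<^bsub>Q1\<^esub> \<tau> z = z \<oplus>\<^bsub>Q1\<^esub> (\<ominus>\<^bsub>Q1\<^esub> \<psi>1 (\<phi>1 z))"
          using z(1) c by (simp add: Q1.M.minus_eq Q1.M.minus_add Q1.M.a_comm)
        then show ?thesis using z(1) c by (simp add: Q1.M.a_lcomm[of "\<psi>1 (\<phi>1 z)"] Q1.M.r_neg)
      qed
      ultimately show "z \<in> H" by simp
    qed
  qed
qed


section \<open>Free modules\<close>

definition regular_module :: "('r, 'x) ring_scheme \<Rightarrow> ('r, 'r) module"
  where "regular_module R =
    \<lparr>carrier = carrier R, mult = undefined, one = undefined,
     zero = \<zero>\<^bsub>R\<^esub>, add = (\<oplus>\<^bsub>R\<^esub>), smult = (\<otimes>\<^bsub>R\<^esub>)\<rparr>"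

lemma left_module_regular_module:
  assumes "ring R"
  shows "left_module R (regular_module R)"
proof -
  interpret ring R by fact
  have "abelian_group (regular_module R)"
    by (rule abelian_groupI) (auto simp: regular_module_def a_ac intro: bexI[of _ "\<ominus>\<^bsub>R\<^esub> _"] l_neg)
  then show ?thesis
    by (intro left_module.intro left_module_axioms.intro ring_axioms)
      (auto simp: regular_module_def l_distr r_distr m_assoc)
qed

lemma projective_regular_module:
  fixes R :: "('r, 'x) ring_scheme"
  assumes R: "ring R"
  shows "projective_module R (regular_module R)"
  unfolding projective_module_def
proof (intro conjI allI impI left_module_regular_module[OF R], elim conjE)
  interpret ring R by fact
  fix N :: "('r, 'r \<Rightarrow> 'r) module" and N' :: "('r, 'r) module" and g h
  assume N: "left_module R N" and N': "left_module R N'"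
    and g: "g \<in> left_module_hom R N N'" and surj: "g ` carrier N = carrier N'"
    and h: "h \<in> left_module_hom R (regular_module R) N'"
  interpret N: left_module R N by fact
  interpret N': left_module R N' by fact
  have h': "h x \<in> carrier N'" "h (a \<otimes>\<^bsub>R\<^esub> x) = a \<odot>\<^bsub>N'\<^esub> h x"
    if "x \<in> carrier R" "a \<in> carrier R" for x a
    using left_module_homD(1,3)[OF h] that by (auto simp: regular_module_def)
  obtain n where n: "n \<in> carrier N" "g n = h \<one>\<^bsub>R\<^esub>"
    using h'(1)[of "\<one>\<^bsub>R\<^esub>" "\<one>\<^bsub>R\<^esub>"] surj by (metis imageE one_closed)
  show "\<exists>k\<in>left_module_hom R (regular_module R) N. \<forall>x\<in>carrier (regular_module R). g (k x) = h x"
  proof (intro bexI ballI)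
    show "(\<lambda>a. a \<odot>\<^bsub>N\<^esub> n) \<in> left_module_hom R (regular_module R) N"
      using n by (auto simp: left_module_hom_def regular_module_def N.smult_l_distr N.smult_assoc1)
    fix x assume "x \<in> carrier (regular_module R)"
    then have x: "x \<in> carrier R" by (simp add: regular_module_def)
    then show "g (x \<odot>\<^bsub>N\<^esub> n) = h x"
      using left_module_homD(3)[OF g x n(1)] n(2) h'(2)[of "\<one>\<^bsub>R\<^esub>" x] by simp
  qed
qed

definition basis_vector :: "('r, 'x) ring_scheme \<Rightarrow> 'b \<Rightarrow> 'b \<Rightarrow> 'r"
  where "basis_vector R x = (\<lambda>y. if y = x then \<one>\<^bsub>R\<^esub> else \<zero>\<^bsub>R\<^esub>)"

lemma basis_vector_in_carrier:
  assumes "ring R" "x \<in> X"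
  shows "basis_vector R x \<in> carrier (free_left_module R X)"
proof -
  interpret ring R by fact
  show ?thesis
    using assms(2)
    by (auto simp: basis_vector_def free_left_module_def intro: finite_subset[of _ "{x}"])
qed

lemma free_left_module_induct [consumes 2, case_names zero add]:
  assumes R: "ring R" and f: "f \<in> carrier (free_left_module R X)"
    and zero: "Q \<zero>\<^bsub>free_left_module R X\<^esub>"
    and add: "\<And>f a x. \<lbrakk>f \<in> carrier (free_left_module R X); Q f; a \<in> carrier R; x \<in> X\<rbrakk> \<Longrightarrow>
      Q (a \<odot>\<^bsub>free_left_module R X\<^esub> basis_vector R x \<oplus>\<^bsub>free_left_module R X\<^esub> f)"
  shows "Q f"
proof -
  interpret ring R by fact
  have "finite {x. f x \<noteq> \<zero>\<^bsub>R\<^esub>}" using f by (simp add: free_left_module_def)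
  then show ?thesis using f
  proof (induction "{x. f x \<noteq> \<zero>\<^bsub>R\<^esub>}" arbitrary: f)
    case empty
    then have "f = \<zero>\<^bsub>free_left_module R X\<^esub>" by (auto simp: free_left_module_def)
    then show ?case using zero by simp
  next
    case (insert x S)
    define f' where "f' = (\<lambda>y. if y = x then \<zero>\<^bsub>R\<^esub> else f y)"
    have val: "f y \<in> carrier R" for y
      using insert.prems by (auto simp: free_left_module_def)
    have x: "x \<in> X" using insert.hyps(4) insert.prems by (auto simp: free_left_module_def)
    have S: "S = {y. f' y \<noteq> \<zero>\<^bsub>R\<^esub>}"
      using insert.hyps(2,4) by (auto simp: f'_def)
    have f': "f' \<in> carrier (free_left_module R X)"
      using insert.prems S insert.hyps(1) by (auto simp: free_left_module_def f'_def)
    have "f = f x \<odot>\<^bsub>free_left_module R X\<^esub> basis_vector R x \<oplus>\<^bsub>free_left_module R X\<^esub> f'"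
      by (rule ext) (simp add: free_left_module_def basis_vector_def f'_def val)
    then show ?case
      using add[OF f' insert.hyps(3)[OF S f'] val x] by metis
  qed
qed

lemma projective_free_left_module:
  fixes R :: "('r, 'x) ring_scheme" and X :: "'b set"
  assumes R: "ring R"
  shows "projective_module R (free_left_module R X)"
  unfolding projective_module_def
proof (intro conjI allI impI left_module_free_left_module[OF R], elim conjE)
  interpret ring R by fact
  let ?F = "free_left_module R X"
  fix N :: "('r, ('b \<Rightarrow> 'r) \<Rightarrow> 'r) module" and N' :: "('r, 'b \<Rightarrow> 'r) module" and g h
  assume N: "left_module R N" and N': "left_module R N'"
    and g: "g \<in> left_module_hom R N N'" and surj: "g ` carrier N = carrier N'"
    and h: "h \<in> left_module_hom R ?F N'"
  interpret N: left_module R N by fact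
  interpret N': left_module R N' by fact
  interpret F: left_module R ?F by (rule left_module_free_left_module[OF R])
  note h' = left_module_homD[OF h] and g' = left_module_homD[OF g]
  have "\<forall>x\<in>X. \<exists>n\<in>carrier N. g n = h (basis_vector R x)"
    using surj h'(1)[OF basis_vector_in_carrier[OF R]] by (metis imageE)
  then obtain v where v: "\<And>x. x \<in> X \<Longrightarrow> v x \<in> carrier N \<and> g (v x) = h (basis_vector R x)"
    by metis
  then have v': "v \<in> X \<rightarrow> carrier N" by auto
  note k = linear_extension_hom[OF N v']
  note k' = left_module_homD[OF k]
  have k_basis: "linear_extension R N v (basis_vector R x) = v x" if x: "x \<in> X" for x
  proof -
    have "linear_extension R N v (basis_vector R x) = (\<Oplus>\<^bsub>N\<^esub>y\<in>{x}. basis_vector R x y \<odot>\<^bsub>N\<^esub> v y)"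
      using x by (intro linear_extension_superset[OF N v' basis_vector_in_carrier[OF R x]])
        (auto simp: basis_vector_def)
    then show ?thesis using v[OF x] by (simp add: basis_vector_def)
  qed
  show "\<exists>k\<in>left_module_hom R ?F N. \<forall>x\<in>carrier ?F. g (k x) = h x"
  proof (intro bexI ballI)
    fix f assume "f \<in> carrier ?F"
    with R show "g (linear_extension R N v f) = h f"
    proof (induction f rule: free_left_module_induct)
      case zero
      then show ?case
        using left_module_hom_zero[OF k F.left_module_axioms N] left_module_hom_zero[OF g N N']
          left_module_hom_zero[OF h F.left_module_axioms N'] by simp
    next
      case (add f a x)
      have b: "basis_vector R x \<in> carrier ?F"
        by (rule basis_vector_in_carrier[OF R add.hyps(3)])
      have ab: "a \<odot>\<^bsub>?F\<^esub> basis_vector R x \<in> carrier ?F"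
        by (rule F.smult_closed[OF add.hyps(2) b])
      have vx: "v x \<in> carrier N" using v[OF add.hyps(3)] by simp
      have "g (linear_extension R N v (a \<odot>\<^bsub>?F\<^esub> basis_vector R x \<oplus>\<^bsub>?F\<^esub> f))
        = g (a \<odot>\<^bsub>N\<^esub> v x \<oplus>\<^bsub>N\<^esub> linear_extension R N v f)"
        by (simp only: k'(2)[OF ab add.hyps(1)] k'(3)[OF add.hyps(2) b] k_basis[OF add.hyps(3)])
      also have "\<dots> = a \<odot>\<^bsub>N'\<^esub> h (basis_vector R x) \<oplus>\<^bsub>N'\<^esub> h f"
        using add vx v[OF add.hyps(3)] k'(1) g' by simp
      also have "\<dots> = h (a \<odot>\<^bsub>?F\<^esub> basis_vector R x \<oplus>\<^bsub>?F\<^esub> f)"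
        by (simp only: h'(2)[OF ab add.hyps(1)] h'(3)[OF add.hyps(2) b])
      finally show ?case .
    qed
  qed (rule k)
qed

lemma finitely_generated_free_left_module:
  assumes R: "ring R" and X: "finite X"
  shows "finitely_generated_module R (free_left_module R X)"
  unfolding finitely_generated_module_def
proof (intro exI conjI allI impI)
  let ?F = "free_left_module R X"
  show "finite (basis_vector R ` X)" using X by simp
  show "basis_vector R ` X \<subseteq> carrier ?F" using basis_vector_in_carrier[OF R] by auto
  fix H assume "submodule H R ?F \<and> basis_vector R ` X \<subseteq> H"
  then have sub: "basis_vector R ` X \<subseteq> H" and "submodule H R ?F" by auto
  interpret H: submodule H R ?F by fact
  have "f \<in> H" if "f \<in> carrier ?F" for f
    using R that
  proof (induction f rule: free_left_module_induct)
    case zero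
    then show ?case using H.one_closed by simp
  next
    case (add f a x)
    then show ?case using H.m_closed[of "a \<odot>\<^bsub>?F\<^esub> basis_vector R x" f] sub by auto
  qed
  then show "H = carrier ?F" using H.subset by auto
qed


section \<open>Chains on the Cayley graph\<close>

text \<open>The \<open>Z\<close>-linear extension of \<open>f\<close> to formal sums.\<close>

definition pairing :: "('m \<Rightarrow> int) \<Rightarrow> ('m \<Rightarrow>\<^sub>0 int) \<Rightarrow> int"
  where "pairing f c = (\<Sum>m\<in>Poly_Mapping.keys c. Poly_Mapping.lookup c m * f m)"

text \<open>Through formal sums over a one-element type, additivity is inherited from
  \<^const>\<open>frag_extend\<close>.\<close>

lemma pairing_frag_extend:
  "pairing f c = Poly_Mapping.lookup (frag_extend (\<lambda>m. frag_cmul (f m) (frag_of ())) c) ()"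
  by (simp add: pairing_def frag_extend_def lookup_sum)

lemma pairing_0 [simp]: "pairing f 0 = 0"
  by (simp add: pairing_def)

lemma pairing_frag_of [simp]: "pairing f (frag_of m) = f m"
  by (simp add: pairing_def)

lemma pairing_add: "pairing f (x + y) = pairing f x + pairing f y"
  by (simp add: pairing_frag_extend frag_extend_add lookup_add)

lemma pairing_diff: "pairing f (x - y) = pairing f x - pairing f y"
  by (simp add: pairing_frag_extend frag_extend_diff lookup_minus)

lemma pairing_cmul: "pairing f (frag_cmul k x) = k * pairing f x"
  by (simp add: pairing_frag_extend frag_extend_cmul)

lemma pairing_sum: "pairing f (sum q I) = (\<Sum>i\<in>I. pairing f (q i))"
  by (induction I rule: infinite_finite_induct) (simp_all add: pairing_add)

lemma pairing_eq_0: "(\<And>m. m \<in> Poly_Mapping.keys c \<Longrightarrow> f m = 0) \<Longrightarrow> pairing f c = 0"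
  by (simp add: pairing_def)

lemma pairing_cong:
  "(\<And>m. m \<in> Poly_Mapping.keys c \<Longrightarrow> f m = g m) \<Longrightarrow> pairing f c = pairing g c"
  by (simp add: pairing_def)

lemma pairing_diff_fun: "pairing (\<lambda>m. f m - g m) c = pairing f c - pairing g c"
  by (simp add: pairing_def algebra_simps sum_subtractf)

lemma carrier_monoid_ring: "x \<in> carrier (monoid_ring M) \<longleftrightarrow> Poly_Mapping.keys x \<subseteq> carrier M"
  by (simp add: monoid_ring_def)

lemma monoid_ring_ops: "x \<oplus>\<^bsub>monoid_ring M\<^esub> y = x + y" "\<zero>\<^bsub>monoid_ring M\<^esub> = 0"
  by (simp_all add: monoid_ring_def)

lemma monoid_ring_mult_diff:
  "(x - y) \<otimes>\<^bsub>monoid_ring M\<^esub> z = x \<otimes>\<^bsub>monoid_ring M\<^esub> z - y \<otimes>\<^bsub>monoid_ring M\<^esub> z"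
  "z \<otimes>\<^bsub>monoid_ring M\<^esub> (x - y) = z \<otimes>\<^bsub>monoid_ring M\<^esub> x - z \<otimes>\<^bsub>monoid_ring M\<^esub> y"
  by (simp_all add: monoid_ring_def frag_extend_diff frag_extend_diff_fun)

lemma monoid_ring_mult_add:
  "(x + y) \<otimes>\<^bsub>monoid_ring M\<^esub> z = x \<otimes>\<^bsub>monoid_ring M\<^esub> z + y \<otimes>\<^bsub>monoid_ring M\<^esub> z"
  "z \<otimes>\<^bsub>monoid_ring M\<^esub> (x + y) = z \<otimes>\<^bsub>monoid_ring M\<^esub> x + z \<otimes>\<^bsub>monoid_ring M\<^esub> y"
  by (simp_all add: monoid_ring_def frag_extend_add frag_extend_add_fun)

lemma monoid_ring_mult_0 [simp]:
  "0 \<otimes>\<^bsub>monoid_ring M\<^esub> z = 0" "z \<otimes>\<^bsub>monoid_ring M\<^esub> 0 = 0"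
  by (simp_all add: monoid_ring_def frag_extend_eq_0)

lemma monoid_ring_mult_sum:
  "z \<otimes>\<^bsub>monoid_ring M\<^esub> sum q I = (\<Sum>i\<in>I. z \<otimes>\<^bsub>monoid_ring M\<^esub> q i)"
  by (induction I rule: infinite_finite_induct) (simp_all add: monoid_ring_mult_add)

lemma monoid_ring_mult_frag_of [simp]:
  "frag_of a \<otimes>\<^bsub>monoid_ring M\<^esub> frag_of b = frag_of (a \<otimes>\<^bsub>M\<^esub> b)"
  by (simp add: monoid_ring_def)

lemma pairing_mult_frag_of:
  "pairing f (frag_of a \<otimes>\<^bsub>monoid_ring M\<^esub> y) = pairing (\<lambda>v. f (a \<otimes>\<^bsub>M\<^esub> v)) y"
  using subset_UNIV
  by (induction y rule: frag_induction) (simp_all add: monoid_ring_mult_diff pairing_diff)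

lemma smult_trivial_module: "r \<odot>\<^bsub>trivial_module M\<^esub> k = pairing (\<lambda>_. 1) r * k"
  by (simp add: trivial_module_def pairing_def)

text \<open>A 1-chain on the right Cayley graph of \<open>M\<close> with respect to \<open>G\<close> assigns to each
  \<open>g \<in> G\<close> the formal sum of the starting points of its edges labelled \<open>g\<close>; it is thus an element of the
  free module on \<open>G\<close>.\<close>

definition boundary ::
  "('m, 'x) monoid_scheme \<Rightarrow> 'm set \<Rightarrow> ('m \<Rightarrow> 'm \<Rightarrow>\<^sub>0 int) \<Rightarrow> 'm \<Rightarrow>\<^sub>0 int"
  where "boundary M G q =
    (\<Sum>g\<in>G. q g \<otimes>\<^bsub>monoid_ring M\<^esub> (frag_of g - frag_of \<one>\<^bsub>M\<^esub>))"

abbreviation chain_module ::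
  "('m, 'x) monoid_scheme \<Rightarrow> 'm set \<Rightarrow> ('m \<Rightarrow>\<^sub>0 int, 'm \<Rightarrow> 'm \<Rightarrow>\<^sub>0 int) module"
  where "chain_module M G \<equiv> free_left_module (monoid_ring M) G"

lemma chain_module_ops:
  "q \<oplus>\<^bsub>chain_module M G\<^esub> q' = (\<lambda>g. q g + q' g)"
  "\<zero>\<^bsub>chain_module M G\<^esub> = (\<lambda>g. 0)"
  "r \<odot>\<^bsub>chain_module M G\<^esub> q = (\<lambda>g. r \<otimes>\<^bsub>monoid_ring M\<^esub> q g)"
  by (simp_all add: free_left_module_def monoid_ring_ops)

lemma chain_in_monoid_ring: "q \<in> carrier (chain_module M G) \<Longrightarrow> q g \<in> carrier (monoid_ring M)"
  by (auto simp: free_left_module_def)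

lemma chain_keys:
  "q \<in> carrier (chain_module M G) \<Longrightarrow> m \<in> Poly_Mapping.keys (q g) \<Longrightarrow> m \<in> carrier M"
  using chain_in_monoid_ring[of q M G g] by (auto simp: carrier_monoid_ring)

lemma regular_module_simps:
  "carrier (regular_module (monoid_ring M)) = carrier (monoid_ring M)"
  "x \<oplus>\<^bsub>regular_module (monoid_ring M)\<^esub> y = x + y"
  "\<zero>\<^bsub>regular_module (monoid_ring M)\<^esub> = 0"
  "r \<odot>\<^bsub>regular_module (monoid_ring M)\<^esub> x = r \<otimes>\<^bsub>monoid_ring M\<^esub> x"
  by (simp_all add: regular_module_def monoid_ring_ops)

lemma frag_of_diff_in_monoid_ring:
  assumes "m \<in> carrier M" "m' \<in> carrier M"
  shows "frag_of m - frag_of m' \<in> carrier (monoid_ring M)"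
  using assms keys_diff[of "frag_of m" "frag_of m'"] by (auto simp: carrier_monoid_ring)

lemma boundary_hom:
  assumes M: "monoid M" and G: "G \<subseteq> carrier M"
  shows "boundary M G \<in> left_module_hom (monoid_ring M) (chain_module M G)
    (regular_module (monoid_ring M))"
proof -
  interpret M: monoid M by fact
  interpret R: ring "monoid_ring M" by (rule ring_monoid_ring[OF M])
  have G': "frag_of g - frag_of \<one>\<^bsub>M\<^esub> \<in> carrier (monoid_ring M)" if "g \<in> G" for g
    using that G by (intro frag_of_diff_in_monoid_ring) auto
  have "boundary M G q \<in> carrier (monoid_ring M)"
    if q: "q \<in> carrier (chain_module M G)" for q
  proof -
    have "Poly_Mapping.keys (q g \<otimes>\<^bsub>monoid_ring M\<^esub> (frag_of g - frag_of \<one>\<^bsub>M\<^esub>)) \<subseteq> carrier M"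
      if "g \<in> G" for g
      using R.m_closed[OF chain_in_monoid_ring[OF q] G'[OF that]] by (simp add: carrier_monoid_ring)
    then show ?thesis
      unfolding boundary_def carrier_monoid_ring by (intro order_trans[OF keys_sum]) auto
  qed
  moreover have "boundary M G (r \<odot>\<^bsub>chain_module M G\<^esub> q) = r \<otimes>\<^bsub>monoid_ring M\<^esub> boundary M G q"
    if "r \<in> carrier (monoid_ring M)" "q \<in> carrier (chain_module M G)" for r q
    unfolding boundary_def chain_module_ops monoid_ring_mult_sum
    using that G' chain_in_monoid_ring[OF that(2)] by (intro sum.cong refl R.m_assoc) auto
  ultimately show ?thesis
    by (auto simp: left_module_hom_def regular_module_simps chain_module_ops(1) boundary_def
        monoid_ring_mult_add sum.distrib)
qed

text \<open>Boundary and coboundary are adjoint: the coboundary of \<open>f\<close> takes the value \<open>f (mg) - f m\<close> on the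
  edge from \<open>m\<close> to \<open>mg\<close>.\<close>

lemma pairing_boundary:
  assumes M: "monoid M" and q: "q \<in> carrier (chain_module M G)"
  shows "pairing f (boundary M G q) = (\<Sum>g\<in>G. pairing (\<lambda>m. f (m \<otimes>\<^bsub>M\<^esub> g) - f m) (q g))"
proof -
  interpret M: monoid M by fact
  have "pairing f (x \<otimes>\<^bsub>monoid_ring M\<^esub> (frag_of g - frag_of \<one>\<^bsub>M\<^esub>))
      = pairing (\<lambda>m. f (m \<otimes>\<^bsub>M\<^esub> g) - f m) x"
    if "Poly_Mapping.keys x \<subseteq> carrier M" for x g
    using that
    by (induction x rule: frag_induction)
      (simp_all add: monoid_ring_mult_diff pairing_diff)
  then show ?thesis
    using chain_in_monoid_ring[OF q]
    unfolding boundary_def pairing_sum carrier_monoid_ring by (intro sum.cong) auto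
qed

definition edge :: "'m \<Rightarrow> 'm \<Rightarrow> 'm \<Rightarrow> 'm \<Rightarrow>\<^sub>0 int"
  where "edge m g = (\<lambda>g'. if g' = g then frag_of m else 0)"

lemma edge_in_chain_module:
  assumes "m \<in> carrier M" "g \<in> G"
  shows "edge m g \<in> carrier (chain_module M G)"
  using assms
  by (auto simp: edge_def free_left_module_def carrier_monoid_ring monoid_ring_ops
      intro: finite_subset[of _ "{g}"])

lemma boundary_edge:
  assumes "monoid M" "finite G" "m \<in> carrier M" "g \<in> G"
  shows "boundary M G (edge m g) = frag_of (m \<otimes>\<^bsub>M\<^esub> g) - frag_of m"
proof -
  interpret monoid M by fact
  have "boundary M G (edge m g) =
    (\<Sum>g'\<in>G. if g' = g then frag_of (m \<otimes>\<^bsub>M\<^esub> g) - frag_of m else 0)"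
    unfolding boundary_def using assms(3)
    by (intro sum.cong refl) (auto simp: edge_def monoid_ring_mult_diff)
  then show ?thesis using assms(2,4) by simp
qed

text \<open>The edges that lead into \<open>C\<close> are those that lead out of \<open>- C\<close>, so this also counts entries.\<close>

definition exits :: "('m, 'x) monoid_scheme \<Rightarrow> 'm set \<Rightarrow> 'm set \<Rightarrow> ('m \<Rightarrow> 'm \<Rightarrow>\<^sub>0 int) \<Rightarrow> int"
  where "exits M G C q =
    (\<Sum>g\<in>G. pairing (\<lambda>m. of_bool (m \<in> C \<and> m \<otimes>\<^bsub>M\<^esub> g \<notin> C)) (q g))"

lemma exits_add: "exits M G C (\<lambda>g. q g + q' g) = exits M G C q + exits M G C q'"
  by (simp add: exits_def pairing_add sum.distrib)

lemma exits_edge: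
  assumes "finite G" "g \<in> G"
  shows "exits M G C (edge m g) = of_bool (m \<in> C \<and> m \<otimes>\<^bsub>M\<^esub> g \<notin> C)"
proof -
  have "exits M G C (edge m g) =
    (\<Sum>g'\<in>G. if g' = g then of_bool (m \<in> C \<and> m \<otimes>\<^bsub>M\<^esub> g \<notin> C) else 0)"
    unfolding exits_def by (intro sum.cong) (auto simp: edge_def)
  then show ?thesis using assms by simp
qed

text \<open>The coboundary of the indicator function of \<open>C\<close> takes the value \<open>1\<close> on entering edges and \<open>-1\<close>
  on leaving ones, and a coboundary vanishes on cycles.\<close>

lemma exits_eq_entries:
  assumes M: "monoid M" and q: "q \<in> carrier (chain_module M G)" and b: "boundary M G q = 0"
  shows "exits M G C q = exits M G (- C) q"
proof -
  have "0 = (\<Sum>g\<in>G. pairing (\<lambda>m. of_bool (m \<otimes>\<^bsub>M\<^esub> g \<in> C) - of_bool (m \<in> C)) (q g))"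
    using pairing_boundary[OF M q, of "\<lambda>m. of_bool (m \<in> C)"] b by simp
  also have "\<dots> = exits M G (- C) q - exits M G C q"
    unfolding exits_def sum_subtractf[symmetric] pairing_diff_fun[symmetric]
    by (intro sum.cong refl pairing_cong) auto
  finally show ?thesis by simp
qed

text \<open>The chain traversed by a path from \<open>u\<close> to \<open>uv\<close>. Its exits from \<open>C\<close> cannot cancel, because every
  edge occurs with positive sign.\<close>

lemma path_chain_exists:
  assumes M: "monoid M" and G: "finite G" "G \<subseteq> carrier M"
    and gen: "\<And>H. \<one>\<^bsub>M\<^esub> \<in> H \<Longrightarrow> (\<And>m g. \<lbrakk>m \<in> H; m \<in> carrier M; g \<in> G\<rbrakk> \<Longrightarrow> m \<otimes>\<^bsub>M\<^esub> g \<in> H)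
      \<Longrightarrow> carrier M \<subseteq> H"
    and u: "u \<in> carrier M" and v: "v \<in> carrier M"
  obtains q where "q \<in> carrier (chain_module M G)"
    "boundary M G q = frag_of (u \<otimes>\<^bsub>M\<^esub> v) - frag_of u"
    "exits M G C q \<ge> of_bool (u \<in> C \<and> u \<otimes>\<^bsub>M\<^esub> v \<notin> C)"
proof -
  interpret M: monoid M by fact
  have R: "ring (monoid_ring M)" by (rule ring_monoid_ring[OF M])
  interpret F: left_module "monoid_ring M" "chain_module M G"
    by (rule left_module_free_left_module[OF R])
  note bd = left_module_homD[OF boundary_hom[OF M G(2)],
      unfolded chain_module_ops regular_module_simps]
  define path where "path v q \<longleftrightarrow> q \<in> carrier (chain_module M G) \<and>
    boundary M G q = frag_of (u \<otimes>\<^bsub>M\<^esub> v) - frag_of u \<and>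
    exits M G C q \<ge> of_bool (u \<in> C \<and> u \<otimes>\<^bsub>M\<^esub> v \<notin> C)" for v q
  have "carrier M \<subseteq> {v. \<exists>q. path v q}"
  proof (rule gen)
    have "path \<one>\<^bsub>M\<^esub> (\<lambda>g. 0)"
      using F.M.zero_closed u
      by (simp add: path_def chain_module_ops boundary_def exits_def)
    then show "\<one>\<^bsub>M\<^esub> \<in> {v. \<exists>q. path v q}" by auto
  next
    fix v g assume "v \<in> {v. \<exists>q. path v q}" and v: "v \<in> carrier M" and g: "g \<in> G"
    then obtain q where q: "path v q" by auto
    have uv: "u \<otimes>\<^bsub>M\<^esub> v \<in> carrier M" using u v by simp
    have assoc: "u \<otimes>\<^bsub>M\<^esub> (v \<otimes>\<^bsub>M\<^esub> g) = u \<otimes>\<^bsub>M\<^esub> v \<otimes>\<^bsub>M\<^esub> g"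
      using u v g G(2) by (intro M.m_assoc[symmetric]) auto
    note e = edge_in_chain_module[OF uv g]
    have "path (v \<otimes>\<^bsub>M\<^esub> g) (\<lambda>g'. q g' + edge (u \<otimes>\<^bsub>M\<^esub> v) g g')"
      using q F.M.a_closed[OF _ e, of q] bd(2)[OF _ e, of q]
      unfolding path_def exits_add exits_edge[OF G(1) g] assoc chain_module_ops
      by (cases "u \<in> C") (auto simp: boundary_edge[OF M G(1) uv g])
    then show "v \<otimes>\<^bsub>M\<^esub> g \<in> {v. \<exists>q. path v q}" by auto
  qed
  then show ?thesis using that v unfolding path_def by blast
qed

text \<open>Exactness in degree \<open>0\<close>: a path from \<open>1\<close> to \<open>m\<close> has boundary \<open>m - 1\<close>, and these differences span
  the augmentation ideal.\<close>

lemma boundary_image: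
  assumes M: "monoid M" and G: "finite G" "G \<subseteq> carrier M"
    and gen: "\<And>H. \<one>\<^bsub>M\<^esub> \<in> H \<Longrightarrow> (\<And>m g. \<lbrakk>m \<in> H; m \<in> carrier M; g \<in> G\<rbrakk> \<Longrightarrow> m \<otimes>\<^bsub>M\<^esub> g \<in> H)
      \<Longrightarrow> carrier M \<subseteq> H"
  shows "boundary M G ` carrier (chain_module M G) =
    a_kernel (regular_module (monoid_ring M)) (trivial_module M) (pairing (\<lambda>_. 1))"
proof -
  interpret M: monoid M by fact
  have R: "ring (monoid_ring M)" by (rule ring_monoid_ring[OF M])
  interpret F: left_module "monoid_ring M" "chain_module M G"
    by (rule left_module_free_left_module[OF R])
  note hom = boundary_hom[OF M G(2)]
  note LR = left_module_regular_module[OF R]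
  note bd = left_module_homD[OF hom]
  have bd_diff: "boundary M G (q \<ominus>\<^bsub>chain_module M G\<^esub> q') = boundary M G q - boundary M G q'"
    if "q \<in> carrier (chain_module M G)" "q' \<in> carrier (chain_module M G)" for q q'
    using left_module_homD(2)[OF hom F.M.minus_closed[OF that] that(2)] that
    by (simp add: F.M.minus_eq F.M.a_assoc F.M.l_neg regular_module_simps)
  have cycle: "pairing (\<lambda>_. 1) (boundary M G q) = 0" if "q \<in> carrier (chain_module M G)" for q
    using pairing_boundary[OF M that, of "\<lambda>_. 1"] by (simp add: pairing_eq_0)
  have bounds: "\<exists>q\<in>carrier (chain_module M G).
      boundary M G q = r - frag_cmul (pairing (\<lambda>_. 1) r) (frag_of \<one>\<^bsub>M\<^esub>)"
    if "Poly_Mapping.keys r \<subseteq> carrier M" for r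
    using that
  proof (induction r rule: frag_induction)
    case zero
    have "boundary M G (\<lambda>g. 0) = 0" by (simp add: boundary_def)
    then show ?case using F.M.zero_closed by (auto simp: chain_module_ops)
  next
    case (one v)
    then obtain q where "q \<in> carrier (chain_module M G)"
      "boundary M G q = frag_of v - frag_of \<one>\<^bsub>M\<^esub>"
      using path_chain_exists[OF M G gen M.one_closed, of v "{}"] by auto
    then show ?case by auto
  next
    case (diff r r')
    then obtain q q' where q: "q \<in> carrier (chain_module M G)" "q' \<in> carrier (chain_module M G)"
      "boundary M G q = r - frag_cmul (pairing (\<lambda>_. 1) r) (frag_of \<one>\<^bsub>M\<^esub>)"
      "boundary M G q' = r' - frag_cmul (pairing (\<lambda>_. 1) r') (frag_of \<one>\<^bsub>M\<^esub>)" by blast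
    then show ?case
      using bd_diff[OF q(1,2)]
      by (intro bexI[of _ "q \<ominus>\<^bsub>chain_module M G\<^esub> q'"] F.M.minus_closed)
        (simp_all add: pairing_diff frag_cmul_diff_distrib)
  qed
  show ?thesis
  proof (intro equalityI subsetI)
    fix r assume "r \<in> boundary M G ` carrier (chain_module M G)"
    then show "r \<in> a_kernel (regular_module (monoid_ring M)) (trivial_module M) (pairing (\<lambda>_. 1))"
      using cycle bd(1) by (auto simp: a_kernel_def' trivial_module_def)
  next
    fix r assume "r \<in> a_kernel (regular_module (monoid_ring M)) (trivial_module M) (pairing (\<lambda>_. 1))"
    then have "Poly_Mapping.keys r \<subseteq> carrier M" "pairing (\<lambda>_. 1) r = 0"
      by (auto simp: a_kernel_def' trivial_module_def regular_module_simps carrier_monoid_ring)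
    then show "r \<in> boundary M G ` carrier (chain_module M G)"
      using bounds[of r] by force
  qed
qed

section \<open>Cuts with distant entrances and exits\<close>

text \<open>The distance between \<open>lo\<close> and \<open>hi\<close> must be unbounded because the finitely many cycles that
  would generate all others are known before the cut is chosen.\<close>

theorem not_type_FP2_if_distant_cuts:
  fixes M :: "('m, 'x) monoid_scheme" and h :: "'m \<Rightarrow> int"
  assumes M: "monoid M" and G: "finite G" "G \<subseteq> carrier M"
    and gen: "\<And>H. \<one>\<^bsub>M\<^esub> \<in> H \<Longrightarrow> (\<And>m g. \<lbrakk>m \<in> H; m \<in> carrier M; g \<in> G\<rbrakk> \<Longrightarrow> m \<otimes>\<^bsub>M\<^esub> g \<in> H)
      \<Longrightarrow> carrier M \<subseteq> H"
    and h: "\<And>u v. \<lbrakk>u \<in> carrier M; v \<in> carrier M\<rbrakk> \<Longrightarrow> h (u \<otimes>\<^bsub>M\<^esub> v) = h u + h v"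
    and cut: "\<And>n. \<exists>C lo hi. hi - lo > n \<and>
      (\<forall>m\<in>carrier M. \<forall>g\<in>G. m \<in> C \<longrightarrow> m \<otimes>\<^bsub>M\<^esub> g \<notin> C \<longrightarrow> h m = lo) \<and>
      (\<forall>m\<in>carrier M. \<forall>g\<in>G. m \<notin> C \<longrightarrow> m \<otimes>\<^bsub>M\<^esub> g \<in> C \<longrightarrow> h m = hi) \<and>
      (\<exists>u\<in>carrier M. \<exists>v\<in>carrier M. \<exists>w\<in>carrier M.
        u \<in> C \<and> u \<otimes>\<^bsub>M\<^esub> v \<notin> C \<and> u \<otimes>\<^bsub>M\<^esub> v \<otimes>\<^bsub>M\<^esub> w = u)"
  shows "\<not> type_FP TYPE('b) 2 M"
proof
  assume "type_FP TYPE('b) 2 M"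
  then obtain P :: "nat \<Rightarrow> ('m \<Rightarrow>\<^sub>0 int, 'b) module" and d e
    where res: "projective_resolution (monoid_ring M) (trivial_module M) P d e"
      and fg: "finitely_generated_module (monoid_ring M) (P 2)"
    unfolding type_FP_def by auto
  interpret M: monoid M by fact
  have R: "ring (monoid_ring M)" by (rule ring_monoid_ring[OF M])
  interpret R: ring "monoid_ring M" by fact
  interpret F: left_module "monoid_ring M" "chain_module M G"
    by (rule left_module_free_left_module[OF R])
  note bd = left_module_homD[OF boundary_hom[OF M G(2)], unfolded regular_module_simps]
  have aug: "pairing (\<lambda>_. 1) \<in>
      left_module_hom (monoid_ring M) (regular_module (monoid_ring M)) (trivial_module M)"
  proof -
    have "pairing (\<lambda>_. 1) (r \<otimes>\<^bsub>monoid_ring M\<^esub> x) = pairing (\<lambda>_. 1) r * pairing (\<lambda>_. 1) x" for r x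
      using subset_UNIV
      by (induction r rule: frag_induction)
        (simp_all add: monoid_ring_mult_diff pairing_diff pairing_mult_frag_of left_diff_distrib)
    then show ?thesis
      by (simp add: left_module_hom_def regular_module_simps smult_trivial_module)
        (simp add: trivial_module_def pairing_add)
  qed
  have "pairing (\<lambda>_. 1) (frag_cmul k (frag_of \<one>\<^bsub>M\<^esub>)) = k" for k
    by (simp add: pairing_cmul)
  moreover have "frag_cmul k (frag_of \<one>\<^bsub>M\<^esub>) \<in> carrier (monoid_ring M)" for k
    by (auto simp: carrier_monoid_ring)
  ultimately have surj: "pairing (\<lambda>_. 1) ` carrier (regular_module (monoid_ring M))
      = carrier (trivial_module M)"
    by (auto simp: regular_module_simps trivial_module_def) (metis image_eqI)
  obtain S where S: "finite S"
    "S \<subseteq> a_kernel (chain_module M G) (regular_module (monoid_ring M)) (boundary M G)"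
    "\<And>H. submodule H (monoid_ring M) (chain_module M G) \<Longrightarrow> S \<subseteq> H \<Longrightarrow>
      a_kernel (chain_module M G) (regular_module (monoid_ring M)) (boundary M G) \<subseteq> H"
    using kernel_finitely_generated[OF res left_module_trivial_module[OF M] fg
        projective_regular_module[OF R] projective_free_left_module[OF R]
        finitely_generated_free_left_module[OF R G(1)] boundary_hom[OF M G(2)] aug surj
        boundary_image[OF M G gen]] by blast
  have S_cycle: "s \<in> carrier (chain_module M G)" "boundary M G s = 0" if "s \<in> S" for s
    using S(2) that by (auto simp: a_kernel_def' regular_module_simps)
  define V where "V = (\<Union>s\<in>S. \<Union>g\<in>G. Poly_Mapping.keys (s g))"
  have "finite V" unfolding V_def using S(1) G(1) by auto
  then obtain B where B: "\<bar>h v\<bar> \<le> B" if "v \<in> V" for v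
    using Max_ge[of "(\<lambda>v. \<bar>h v\<bar>) ` V"] by (metis finite_imageI imageI)
  obtain C lo hi where far: "hi - lo > 2 * B"
    and lo: "\<forall>m\<in>carrier M. \<forall>g\<in>G. m \<in> C \<longrightarrow> m \<otimes>\<^bsub>M\<^esub> g \<notin> C \<longrightarrow> h m = lo"
    and hi: "\<forall>m\<in>carrier M. \<forall>g\<in>G. m \<notin> C \<longrightarrow> m \<otimes>\<^bsub>M\<^esub> g \<in> C \<longrightarrow> h m = hi"
    and "\<exists>u\<in>carrier M. \<exists>v\<in>carrier M. \<exists>w\<in>carrier M.
      u \<in> C \<and> u \<otimes>\<^bsub>M\<^esub> v \<notin> C \<and> u \<otimes>\<^bsub>M\<^esub> v \<otimes>\<^bsub>M\<^esub> w = u"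
    using cut[of "2 * B"] by (elim exE conjE) (rule that)
  then obtain u v w where loop: "u \<in> carrier M" "v \<in> carrier M" "w \<in> carrier M"
      "u \<in> C" "u \<otimes>\<^bsub>M\<^esub> v \<notin> C" "u \<otimes>\<^bsub>M\<^esub> v \<otimes>\<^bsub>M\<^esub> w = u"
    by auto
  \<comment> \<open>Having no exits is not visibly stable under scalars, so stability is built in.\<close>
  define K where "K = {q \<in> carrier (chain_module M G).
    \<forall>r\<in>carrier (monoid_ring M). exits M G C (r \<odot>\<^bsub>chain_module M G\<^esub> q) = 0}"

  have translate: "exits M G C (frag_of a \<odot>\<^bsub>chain_module M G\<^esub> s) = 0"
    if s: "s \<in> S" and a: "a \<in> carrier M" for s a
  proof -
    have fa: "frag_of a \<in> carrier (monoid_ring M)" using a by (simp add: carrier_monoid_ring)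
    have exits_eq: "exits M G D (frag_of a \<odot>\<^bsub>chain_module M G\<^esub> s) =
        (\<Sum>g\<in>G. pairing (\<lambda>m. of_bool (a \<otimes>\<^bsub>M\<^esub> m \<in> D \<and> a \<otimes>\<^bsub>M\<^esub> m \<otimes>\<^bsub>M\<^esub> g \<notin> D)) (s g))" for D
      by (simp add: exits_def chain_module_ops pairing_mult_frag_of)
    have key: "m \<in> carrier M \<and> \<bar>h m\<bar> \<le> B" if "g \<in> G" "m \<in> Poly_Mapping.keys (s g)" for g m
      using that B[of m] s chain_keys[OF S_cycle(1)[OF s]] by (auto simp: V_def)
    show ?thesis
    proof (cases "\<exists>g\<in>G. \<exists>m\<in>Poly_Mapping.keys (s g). a \<otimes>\<^bsub>M\<^esub> m \<in> C \<and> a \<otimes>\<^bsub>M\<^esub> m \<otimes>\<^bsub>M\<^esub> g \<notin> C")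
      case False
      then show ?thesis
        unfolding exits_eq by (intro sum.neutral ballI pairing_eq_0) auto
    next
      case True
      then obtain g m where gm: "g \<in> G" "m \<in> Poly_Mapping.keys (s g)"
        "a \<otimes>\<^bsub>M\<^esub> m \<in> C" "a \<otimes>\<^bsub>M\<^esub> m \<otimes>\<^bsub>M\<^esub> g \<notin> C" by blast
      have am: "m \<in> carrier M" "a \<otimes>\<^bsub>M\<^esub> m \<in> carrier M" using key[OF gm(1,2)] a by auto
      have "h (a \<otimes>\<^bsub>M\<^esub> m) = lo" using lo am(2) gm(1,3,4) by blast
      then have m: "h a + h m = lo" using h[OF a am(1)] by simp
      \<comment> \<open>An exit and an entry in the same translate would lie further apart than \<open>2 * B\<close>.\<close>
      have no_entry: "\<not> (a \<otimes>\<^bsub>M\<^esub> m' \<notin> C \<and> a \<otimes>\<^bsub>M\<^esub> m' \<otimes>\<^bsub>M\<^esub> g' \<in> C)"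
        if "g' \<in> G" "m' \<in> Poly_Mapping.keys (s g')" for g' m'
      proof
        assume "a \<otimes>\<^bsub>M\<^esub> m' \<notin> C \<and> a \<otimes>\<^bsub>M\<^esub> m' \<otimes>\<^bsub>M\<^esub> g' \<in> C"
        moreover have am': "m' \<in> carrier M" "a \<otimes>\<^bsub>M\<^esub> m' \<in> carrier M"
          using key[OF that] a by auto
        ultimately have "h (a \<otimes>\<^bsub>M\<^esub> m') = hi" using hi that(1) by blast
        then have "h a + h m' = hi" using h[OF a am'(1)] by simp
        then show False using m far key[OF gm(1,2)] key[OF that] by linarith
      qed
      have "boundary M G (frag_of a \<odot>\<^bsub>chain_module M G\<^esub> s) = 0"
        using bd(3)[OF fa S_cycle(1)[OF s]] S_cycle(2)[OF s] by simp
      then have "exits M G C (frag_of a \<odot>\<^bsub>chain_module M G\<^esub> s) =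
          exits M G (- C) (frag_of a \<odot>\<^bsub>chain_module M G\<^esub> s)"
        by (intro exits_eq_entries[OF M F.smult_closed[OF fa S_cycle(1)[OF s]]])
      also have "\<dots> = 0"
        unfolding exits_eq using no_entry by (intro sum.neutral ballI pairing_eq_0) auto
      finally show ?thesis .
    qed
  qed
  have S_K: "S \<subseteq> K"
  proof
    fix s assume s: "s \<in> S"
    have "exits M G C (r \<odot>\<^bsub>chain_module M G\<^esub> s) = 0" if "Poly_Mapping.keys r \<subseteq> carrier M" for r
      using that
    proof (induction r rule: frag_induction)
      case (one a)
      then show ?case using translate[OF s] by simp
    qed (simp_all add: chain_module_ops exits_def monoid_ring_mult_diff pairing_diff sum_subtractf)
    then show "s \<in> K" using S_cycle(1)[OF s] by (simp add: K_def carrier_monoid_ring)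
  qed
  have sub_K: "submodule K (monoid_ring M) (chain_module M G)"
  proof (intro submodule.intro subgroup.intro submodule_axioms.intro)
    show "K \<subseteq> carrier (add_monoid (chain_module M G))" by (auto simp: K_def)
    show "\<one>\<^bsub>add_monoid (chain_module M G)\<^esub> \<in> K"
      using F.M.zero_closed by (simp add: K_def) (simp add: chain_module_ops exits_def)
  next
    fix q q' assume "q \<in> K" "q' \<in> K"
    then show "q \<otimes>\<^bsub>add_monoid (chain_module M G)\<^esub> q' \<in> K"
      by (simp add: K_def F.smult_r_distr) (simp add: chain_module_ops exits_add)
  next
    fix q assume q: "q \<in> K"
    then have q': "q \<in> carrier (chain_module M G)" by (simp add: K_def)
    have "exits M G C (r \<odot>\<^bsub>chain_module M G\<^esub> (\<ominus>\<^bsub>chain_module M G\<^esub> q)) = 0"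
      if r: "r \<in> carrier (monoid_ring M)" for r
    proof -
      have "r \<odot>\<^bsub>chain_module M G\<^esub> (\<ominus>\<^bsub>chain_module M G\<^esub> q) \<oplus>\<^bsub>chain_module M G\<^esub>
          r \<odot>\<^bsub>chain_module M G\<^esub> q = (\<lambda>g. 0)"
        using q' r F.smult_r_distr[of r "\<ominus>\<^bsub>chain_module M G\<^esub> q" q]
        by (simp add: F.M.l_neg) (simp add: chain_module_ops)
      then have "exits M G C (r \<odot>\<^bsub>chain_module M G\<^esub> (\<ominus>\<^bsub>chain_module M G\<^esub> q)) +
          exits M G C (r \<odot>\<^bsub>chain_module M G\<^esub> q) = exits M G C (\<lambda>g. 0)"
        by (simp add: chain_module_ops(1) flip: exits_add)
      then show ?thesis using q r by (simp add: K_def) (simp add: exits_def)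
    qed
    then have "\<ominus>\<^bsub>chain_module M G\<^esub> q \<in> K" using q' by (simp add: K_def)
    then show "inv\<^bsub>add_monoid (chain_module M G)\<^esub> q \<in> K" by (simp add: a_inv_def)
  next
    fix r q assume r: "r \<in> carrier (monoid_ring M)" and q: "q \<in> K"
    then show "r \<odot>\<^bsub>chain_module M G\<^esub> q \<in> K"
      by (simp add: K_def F.smult_assoc1[symmetric])
  qed
  have K: "exits M G C q = 0"
    if "q \<in> carrier (chain_module M G)" "boundary M G q = 0" for q
  proof -
    have "q \<in> K"
      using S(3)[OF sub_K S_K] that
      by (auto simp: a_kernel_def' regular_module_simps)
    then have "exits M G C (\<one>\<^bsub>monoid_ring M\<^esub> \<odot>\<^bsub>chain_module M G\<^esub> q) = 0"
      using R.one_closed unfolding K_def by blast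
    then show ?thesis using that by simp
  qed
  obtain q1 where q1: "q1 \<in> carrier (chain_module M G)"
    "boundary M G q1 = frag_of (u \<otimes>\<^bsub>M\<^esub> v) - frag_of u" "exits M G C q1 \<ge> 1"
    using path_chain_exists[OF M G gen loop(1,2), of C] loop(4,5) by auto
  obtain q2 where q2: "q2 \<in> carrier (chain_module M G)"
    "boundary M G q2 = frag_of u - frag_of (u \<otimes>\<^bsub>M\<^esub> v)" "exits M G C q2 \<ge> 0"
    using path_chain_exists[OF M G gen _ loop(3), of "u \<otimes>\<^bsub>M\<^esub> v" C] loop by auto
  have "exits M G C (q1 \<oplus>\<^bsub>chain_module M G\<^esub> q2) = 0"
    using q1 q2 bd(2)[OF q1(1) q2(1)] by (intro K) auto
  then show False using q1(3) q2(3) by (simp add: chain_module_ops exits_add)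
qed

section \<open>Hysteresis\<close>

definition letter_height :: "'a + 'a \<Rightarrow> int"
  where "letter_height x = case_sum (\<lambda>_. 1) (\<lambda>_. - 1) x"

definition word_height :: "('a + 'a) list \<Rightarrow> int"
  where "word_height w = sum_list (map letter_height w)"

text \<open>The flag records which of the zones \<open>p \<le> 0\<close> and \<open>p \<ge> N\<close> was visited last.\<close>

fun hysteresis :: "int \<Rightarrow> bool \<times> int \<Rightarrow> 'a + 'a \<Rightarrow> bool \<times> int"
  where "hysteresis N (b, p) x =
    (let p' = p + letter_height x in (if p' \<le> 0 then False else if N \<le> p' then True else b, p'))"

text \<open>Inside a zone the flag is determined by the zone. From the other states \<open>w w\<^sup>\<star> w\<close> and \<open>w\<close> may
  act differently: the path of \<open>w\<^sup>\<star>\<close> ends with a visit to a zone that \<open>w\<close> alone does not make.\<close>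

definition consistent :: "int \<Rightarrow> bool \<times> int \<Rightarrow> bool"
  where "consistent N s \<longleftrightarrow> (snd s \<le> 0 \<longrightarrow> \<not> fst s) \<and> (N \<le> snd s \<longrightarrow> fst s)"

lemma word_height_append [simp]: "word_height (u @ v) = word_height u + word_height v"
  by (simp add: word_height_def)

lemma letter_height_star: "letter_height (case_sum Inr Inl x) = - letter_height x"
  by (cases x) (simp_all add: letter_height_def)

lemma word_height_star [simp]: "word_height (word_star w) = - word_height w"
  by (induction w) (simp_all add: word_height_def word_star_def letter_height_star)

lemma foldl_hysteresis_height: "snd (foldl (hysteresis N) s w) = snd s + word_height w"
  by (induction w arbitrary: s) (auto simp: word_height_def Let_def)

lemma consistent_hysteresis: "0 < N \<Longrightarrow> consistent N (hysteresis N s x)"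
  by (cases s) (auto simp: consistent_def Let_def)

lemma consistent_foldl_hysteresis:
  "0 < N \<Longrightarrow> consistent N s \<Longrightarrow> consistent N (foldl (hysteresis N) s w)"
  by (induction w arbitrary: s) (auto simp: consistent_hysteresis)

text \<open>By induction on \<open>w\<close>. Let \<open>t\<close> be the state after the first letter \<open>x\<close> of \<open>xw\<close>, and \<open>t'\<close> the one
  after \<open>x w w\<^sup>\<star>\<close>. They have the same height, and \<open>w\<close> leads from both to the same state, by the induction
  hypothesis. The excursion \<open>x\<^sup>\<star> x\<close> from \<open>t'\<close> ends in \<open>t\<close> if it visits a zone with its first step, since
  the flag there is that of the state before \<open>x\<close>, and it ends in \<open>t'\<close> otherwise.\<close>

lemma hysteresis_return:
  assumes N: "0 < N" and s: "consistent N s"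
  shows "foldl (hysteresis N) s (w @ word_star w @ w) = foldl (hysteresis N) s w"
  using s
proof (induction w arbitrary: s)
  case (Cons x w)
  define t where "t = hysteresis N s x"
  define t' where "t' = foldl (hysteresis N) t (w @ word_star w)"
  have t: "consistent N t" unfolding t_def by (rule consistent_hysteresis[OF N])
  have t': "consistent N t'" unfolding t'_def by (rule consistent_foldl_hysteresis[OF N t])
  have "snd t' = snd t" by (simp add: t'_def foldl_hysteresis_height)
  have IH: "foldl (hysteresis N) t' w = foldl (hysteresis N) t w"
    using Cons.IH[OF t] by (simp add: t'_def)
  have "hysteresis N (hysteresis N t' (case_sum Inr Inl x)) x \<in> {t, t'}"
    using t' \<open>snd t' = snd t\<close> Cons.prems N
    by (cases s; cases t') (auto simp: t_def consistent_def Let_def letter_height_star)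
  then have "foldl (hysteresis N) (hysteresis N (hysteresis N t' (case_sum Inr Inl x)) x) w
      = foldl (hysteresis N) t w"
    using IH by auto
  then show ?case by (simp add: t'_def t_def word_star_def)
qed (simp add: word_star_def)

lemma hysteresis_flip:
  assumes "0 < N" "consistent N s" "fst (hysteresis N s x) \<noteq> fst s"
  shows "snd s = (if fst s then 1 else N - 1)"
  using assms
  by (cases s; cases x) (auto simp: consistent_def letter_height_def Let_def split: if_splits)

lemma hysteresis_climb:
  assumes "0 < N" "p + int k < N" "0 \<le> p"
  shows "foldl (hysteresis N) (False, p) (replicate k (Inl a)) = (False, p + int k)"
  using assms by (induction k arbitrary: p) (auto simp: Let_def letter_height_def)

lemma hysteresis_descend:
  assumes "0 < N" "0 < p - int k" "p \<le> N"
  shows "foldl (hysteresis N) (True, p) (replicate k (Inr a)) = (True, p - int k)"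
  using assms by (induction k arbitrary: p) (auto simp: Let_def letter_height_def)


section \<open>Functions on the free regular \<open>\<star>\<close>-monoid\<close>

lemma presentation_congruence_invariant:
  assumes "(u, v) \<in> presentation_congruence X R"
    and "\<And>u v p q. (u, v) \<in> R \<Longrightarrow> f (p @ u @ q) = f (p @ v @ q)"
  shows "f u = f v"
  using assms(1) by (induction rule: presentation_congruence.induct) (simp_all add: assms(2))

abbreviation star_relations :: "'a set \<Rightarrow> (('a + 'a) list \<times> ('a + 'a) list) set"
  where "star_relations A \<equiv> {(w @ word_star w @ w, w) | w. w \<in> lists (A <+> A)}"

abbreviation star_class :: "'a set \<Rightarrow> ('a + 'a) list \<Rightarrow> ('a + 'a) list set"
  where "star_class A w \<equiv> presentation_congruence (A <+> A) (star_relations A) `` {w}"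

lemma star_class_mult:
  assumes "u \<in> lists (A <+> A)" "v \<in> lists (A <+> A)"
  shows "star_class A u \<otimes>\<^bsub>free_regular_star_monoid A\<^esub> star_class A v = star_class A (u @ v)"
  unfolding free_regular_star_monoid_def using assms by (rule presented_monoid_mult)

lemma carrier_free_regular_star_monoid:
  "carrier (free_regular_star_monoid A) = star_class A ` lists (A <+> A)"
  unfolding free_regular_star_monoid_def presented_monoid_def by (auto simp: quotient_def)

lemma one_free_regular_star_monoid: "\<one>\<^bsub>free_regular_star_monoid A\<^esub> = star_class A []"
  by (simp add: free_regular_star_monoid_def presented_monoid_def)

lemma star_class_eqI:
  "w \<in> lists (A <+> A) \<Longrightarrow> star_class A (w @ word_star w @ w) = star_class A w"
  using presentation_congruence.step[of "w @ word_star w @ w" w "star_relations A" "A <+> A" "[]" "[]"]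
  by (intro equiv_class_eq[OF equiv_presentation_congruence]) (auto simp: word_star_in_lists)

definition on_class :: "('x list \<Rightarrow> 'b) \<Rightarrow> 'x list set \<Rightarrow> 'b"
  where "on_class f U = f (SOME u. u \<in> U)"

lemma on_class_star_class:
  assumes f: "\<And>p q w. f (p @ (w @ word_star w @ w) @ q) = f (p @ w @ q)"
    and w: "w \<in> lists (A <+> A)"
  shows "on_class f (star_class A w) = f w"
proof -
  have "w \<in> star_class A w" using w by (auto intro: presentation_congruence.refl)
  then have "(SOME u. u \<in> star_class A w) \<in> star_class A w" by (rule someI)
  then have "(w, SOME u. u \<in> star_class A w) \<in> presentation_congruence (A <+> A) (star_relations A)"
    by simp
  then have "f w = f (SOME u. u \<in> star_class A w)"
    by (rule presentation_congruence_invariant) (use f in auto)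
  then show ?thesis by (simp add: on_class_def)
qed

theorem corollary3p1:
  fixes A :: "'a set" and r :: nat
  assumes "r \<ge> 1" and "finite A" and "card A = r"
  shows "\<not> type_FP TYPE('b) 2 (free_regular_star_monoid A)"
proof (rule not_type_FP2_if_distant_cuts)
  let ?X = "A <+> A"
  let ?M = "free_regular_star_monoid A"
  let ?h = "on_class word_height"
  show "monoid ?M" by (rule monoid_free_regular_star_monoid)
  show "finite ((\<lambda>x. star_class A [x]) ` ?X)" using assms(2) by simp
  show "(\<lambda>x. star_class A [x]) ` ?X \<subseteq> carrier ?M"
    by (auto simp: carrier_free_regular_star_monoid)
  have h: "?h (star_class A w) = word_height w" if "w \<in> lists ?X" for w
    using that by (intro on_class_star_class) simp_all
  show "?h (U \<otimes>\<^bsub>?M\<^esub> V) = ?h U + ?h V" if "U \<in> carrier ?M" "V \<in> carrier ?M" for U V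
  proof -
    obtain u v where uv: "U = star_class A u" "V = star_class A v" "u \<in> lists ?X" "v \<in> lists ?X"
      using \<open>U \<in> _\<close> \<open>V \<in> _\<close> by (auto simp only: carrier_free_regular_star_monoid)
    then show ?thesis
      using h[of u] h[of v] h[of "u @ v"] by (simp add: star_class_mult)
  qed
  show "carrier ?M \<subseteq> H"
    if one: "\<one>\<^bsub>?M\<^esub> \<in> H"
      and step: "\<And>m g. \<lbrakk>m \<in> H; m \<in> carrier ?M; g \<in> (\<lambda>x. star_class A [x]) ` ?X\<rbrakk> \<Longrightarrow> m \<otimes>\<^bsub>?M\<^esub> g \<in> H"
    for H
  proof -
    have "star_class A w \<in> H" if "w \<in> lists ?X" for w
      using that
    proof (induction w rule: rev_induct)
      case Nil
      then show ?case using one by (simp add: one_free_regular_star_monoid)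
    next
      case (snoc x w)
      then show ?case
        using step[of "star_class A w" "star_class A [x]"] star_class_mult[of w A "[x]"]
        by (auto simp: carrier_free_regular_star_monoid)
    qed
    then show ?thesis by (auto simp: carrier_free_regular_star_monoid)
  qed

  fix n :: int
  \<comment> \<open>\<open>Suc k\<close> is \<open>N\<close>; the words \<open>up\<close> and \<open>down\<close> below flip the flag with their last letter.\<close>
  define k where "k = nat (max n 0 + 2)"
  define N where "N = int (Suc k)"
  have N: "0 < N" "n < N - 2" by (auto simp: N_def k_def)
  define state where "state w = foldl (hysteresis N) (False, 0) w" for w :: "('a + 'a) list"
  have consistent: "consistent N (state w)" for w
    unfolding state_def using N(1)
    by (intro consistent_foldl_hysteresis) (simp_all add: consistent_def)
  have "state (p @ (w @ word_star w @ w) @ q) = state (p @ w @ q)" for p q w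
    using hysteresis_return[OF N(1) consistent[of p], of w] by (simp add: state_def)
  note state_class = on_class_star_class[of state, OF this]
  define C where "C = {U. fst (on_class state U)}"
  have C: "star_class A w \<in> C \<longleftrightarrow> fst (state w)" if "w \<in> lists ?X" for w
    using state_class[OF that] by (simp add: C_def)
  have flip: "?h m = (if m \<in> C then 1 else N - 1)"
    if m: "m \<in> carrier ?M" and g: "g \<in> (\<lambda>x. star_class A [x]) ` ?X"
      and change: "(m \<otimes>\<^bsub>?M\<^esub> g \<in> C) \<noteq> (m \<in> C)" for m g
  proof -
    obtain w x where w: "m = star_class A w" "w \<in> lists ?X" and x: "g = star_class A [x]" "x \<in> ?X"
      using m g by (auto simp only: carrier_free_regular_star_monoid)
    have wx: "w @ [x] \<in> lists ?X" using w(2) x(2) by simp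
    have "m \<otimes>\<^bsub>?M\<^esub> g = star_class A (w @ [x])"
      unfolding w(1) x(1) using w(2) x(2) by (intro star_class_mult) simp_all
    then have "fst (hysteresis N (state w) x) \<noteq> fst (state w)"
      using change C[OF w(2)] C[OF wx] w(1) by (simp add: state_def)
    then have "snd (state w) = (if fst (state w) then 1 else N - 1)"
      by (rule hysteresis_flip[OF N(1) consistent])
    moreover have "snd (state w) = ?h m"
      unfolding w(1) h[OF w(2)] by (simp add: state_def foldl_hysteresis_height)
    ultimately show ?thesis using C[OF w(2)] w(1) by simp
  qed
  obtain a where a: "a \<in> A" using assms by fastforce
  define up :: "('a + 'a) list" where "up = replicate (Suc k) (Inl a)"
  define down :: "('a + 'a) list" where "down = replicate (Suc k) (Inr a)"
  have X: "up \<in> lists ?X" "down \<in> lists ?X" using a by (auto simp: up_def down_def in_lists_conv_set)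
  have "down = word_star up" by (simp add: up_def down_def word_star_def replicate_append_same)
  have up: "state up = (True, N)"
    using hysteresis_climb[OF N(1), of 0 k a]
    by (simp add: state_def up_def N_def letter_height_def Let_def flip: replicate_append_same)
  have "down = replicate k (Inr a) @ [Inr a]" by (simp add: down_def replicate_append_same)
  then have "state (up @ down) =
      hysteresis N (foldl (hysteresis N) (True, N) (replicate k (Inr a))) (Inr a)"
    using up by (simp add: state_def)
  also have "\<dots> = (False, 0)"
    using hysteresis_descend[OF N(1), of N k a] by (simp add: N_def letter_height_def)
  finally have "state (up @ down) = (False, 0)" .
  then have "star_class A up \<in> C" "star_class A up \<otimes>\<^bsub>?M\<^esub> star_class A down \<notin> C"
    "star_class A up \<otimes>\<^bsub>?M\<^esub> star_class A down \<otimes>\<^bsub>?M\<^esub> star_class A up = star_class A up"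
    using X up star_class_eqI[OF X(1)] C[OF X(1)] C[of "up @ down"]
    by (simp_all add: star_class_mult \<open>down = word_star up\<close>)
  moreover have "star_class A up \<in> carrier ?M" "star_class A down \<in> carrier ?M"
    using X by (auto simp: carrier_free_regular_star_monoid)
  ultimately have "\<exists>u\<in>carrier ?M. \<exists>v\<in>carrier ?M. \<exists>w\<in>carrier ?M.
      u \<in> C \<and> u \<otimes>\<^bsub>?M\<^esub> v \<notin> C \<and> u \<otimes>\<^bsub>?M\<^esub> v \<otimes>\<^bsub>?M\<^esub> w = u" by blast
  then show "\<exists>C lo hi. hi - lo > n \<and>
      (\<forall>m\<in>carrier ?M. \<forall>g\<in>(\<lambda>x. star_class A [x]) ` ?X. m \<in> C \<longrightarrow> m \<otimes>\<^bsub>?M\<^esub> g \<notin> C \<longrightarrow> ?h m = lo) \<and>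
      (\<forall>m\<in>carrier ?M. \<forall>g\<in>(\<lambda>x. star_class A [x]) ` ?X. m \<notin> C \<longrightarrow> m \<otimes>\<^bsub>?M\<^esub> g \<in> C \<longrightarrow> ?h m = hi) \<and>
      (\<exists>u\<in>carrier ?M. \<exists>v\<in>carrier ?M. \<exists>w\<in>carrier ?M.
        u \<in> C \<and> u \<otimes>\<^bsub>?M\<^esub> v \<notin> C \<and> u \<otimes>\<^bsub>?M\<^esub> v \<otimes>\<^bsub>?M\<^esub> w = u)"
    using N(2) flip by (intro exI[of _ C] exI[of _ 1] exI[of _ "N - 1"]) auto
qed

end
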